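(* Let $A\in\mathbb{C}^{n\times n}$ be skew-Hermitian, let $B\in\mathbb{C}^{n\times m}$, and let $A_{\mathrm{cl.loop}}$ be the closed-loop matrix of the associated linear quadratic regulator problem, with $\lambda_k$, $b_k$, $\delta_k$, $\Delta$, $T_k$ as in the context. For $1\le k\le n$ put $$\rho_k=\frac{\|b_k\|}{1+2\frac{\|B\|^2}{\delta_k^2}},\qquad \rho^1_k=\frac{\|b_k\|}{\sqrt{1+2\frac{\|B\|^2}{\delta_k^2}}}.$$ Then: (1) The eigenvalues of $A_{\mathrm{cl.loop}}$ lie in the box $[-\|B\|,0)\times[\lambda_1,\lambda_n]$, outside the triangles $T_k$ ($1\le k\le n-1$), and outside the closed disks centered at $i\lambda_k$ of radii $\rho_k$ ($1\le k\le n$). (2) If moreover the smallest singular value $\sigma_m$ of $B$ satisfies $\sigma_m>2\sqrt2\,\Delta$, then exactly $m$ eigenvalues of $A_{\mathrm{cl.loop}}$ (counted with multiplicity) lie in the box $[-\|B\|,-\frac{\sqrt6}{4}\sigma_m]\times[\lambda_1,\lambda_n]$, and the other $n-m$ eigenvalues lie in the box $(-\sqrt3\,\Delta,0)\times[\lambda_1,\lambda_n]$. (3) If $m=1$, then assertion (1) holds for the disks with the same centers and the larger radii $\rho^1_k$ instead of $\rho_k$.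
   Context: Standing setting: $n\ge 2$, $1\le m\le n$; $A\in\mathbb{C}^{n\times n}$ is skew-Hermitian ($A^*=-A$); $B\in\mathbb{C}^{n\times m}$ with $\ker B=\{0\}$; the pair $(A,B)$ is stabilizable (equivalently, since $A$ is skew-Hermitian, controllable). $\|\cdot\|$ is the Euclidean norm of vectors and the induced operator norm of matrices. Linear quadratic regulator: for $x'(t)=Ax(t)+Bu(t)$, $x(0)=x_0$, minimize $J^u(x_0)=\int_0^\infty x(t)^*x(t)+u(t)^*u(t)\,dt$. The optimal control is $u=-Fx$, $F=B^*X$, where $X$ is the unique nonnegative (in fact positive definite) solution of $XBB^*X-XA-A^*X-I=0$. The closed-loop matrix is $A_{\mathrm{cl.loop}}=A-BF=A-BB^*X$; it is stable (its spectrum lies in $\{\operatorname{Re} z<0\}$). Notation: the eigenvalues of $A$, listed with multiplicity, are $i\lambda_1,\dots,i\lambda_n$ with $\lambda_1\le\dots\le\lambda_n$ real; $v_1,\dots,v_n$ is an orthonormal basis of $\mathbb{C}^n$ with $Av_j=i\lambda_jv_j$; $b_j=B^*v_j$; $\delta_k=\min_{j\ne k}|\lambda_j-\lambda_k|$; $\Delta=\lambda_n-\lambda_1$. If $\delta_k=0$, then $\rho_k=\rho_k^1=0$ by convention. For $1\le k\le n-1$, $T_k$ is the closed (right) triangle in $\mathbb{C}$ with vertices $i\lambda_k$, $i\lambda_{k+1}$ and $-\frac{\lambda_{k+1}-\lambda_k}{2}+i\,\frac{\lambda_{k+1}+\lambda_k}{2}$. A box $I\times J$ denotes $\{z\in\mathbb{C}:\operatorname{Re}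 z\in I,\ \operatorname{Im} z\in J\}$. *)

theory Defs
  imports
    "Jordan_Normal_Form.Spectral_Radius"
    "Jordan_Normal_Form.Schur_Decomposition"
    "Jordan_Normal_Form.Matrix_Kernel"
    "HOL-Analysis.Elementary_Metric_Spaces"
    "HOL-Analysis.Convex"
begin

type_synonym cvec = "complex vec"

definition vec_norm :: "complex vec \<Rightarrow> real" where
  "vec_norm v = sqrt (\<Sum>i<dim_vec v. (cmod (vec_index v i))\<^sup>2)"

definition op_norm :: "complex mat \<Rightarrow> real" where
  "op_norm M = (SUP x \<in> {x \<in> carrier_vec (dim_col M). vec_norm x \<le> 1}. vec_norm (M *\<^sub>v x))"

text \<open>The singular values of an \<open>n \<times> m\<close> matrix with \<open>m \<le> n\<close> are the square roots of the
  \<open>m\<close> eigenvalues of \<open>B\<^sup>* B\<close> (with the zero eigenvalues included). For \<open>m > n\<close> one would use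
  \<open>B B\<^sup>*\<close> instead; that case does not occur here.\<close>

definition singular_value :: "complex mat \<Rightarrow> real \<Rightarrow> bool" where
  "singular_value B s \<longleftrightarrow> 0 \<le> s \<and> eigenvalue (mat_adjoint B * B) (complex_of_real (s\<^sup>2))"

definition smallest_singular_value :: "complex mat \<Rightarrow> real" where
  "smallest_singular_value B = Min {s. singular_value B s}"

definition skew_hermitian :: "complex mat \<Rightarrow> bool" where
  "skew_hermitian A \<longleftrightarrow> mat_adjoint A = - A"

definition stable_mat :: "complex mat \<Rightarrow> bool" where
  "stable_mat M \<longleftrightarrow> (\<forall>\<mu> \<in> spectrum M. Re \<mu> < 0)"

definition stabilizable :: "complex mat \<Rightarrow> complex mat \<Rightarrow> bool" where
  "stabilizable A B \<longleftrightarrow>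
     (\<exists>F \<in> carrier_mat (dim_col B) (dim_row B). stable_mat (A - B * F))"

definition nonneg_mat :: "complex mat \<Rightarrow> bool" where
  "nonneg_mat X \<longleftrightarrow> X \<in> carrier_mat (dim_row X) (dim_row X) \<and> mat_adjoint X = X \<and>
     (\<forall>x \<in> carrier_vec (dim_row X). 0 \<le> Re (scalar_prod (X *\<^sub>v x) (conjugate x)))"

text \<open>For the cost \<open>\<integral> x\<^sup>* x + u\<^sup>* u dt\<close> subject to \<open>x' = A x + B u\<close> the optimal control is
  \<open>u = - B\<^sup>* X x\<close>, where \<open>X\<close> is the nonnegative solution of the algebraic Riccati equation.
  For stabilizable \<open>(A, B)\<close> this solution exists and is unique.\<close>

definition lqr_riccati_solution :: "complex mat \<Rightarrow> complex mat \<Rightarrow> complex mat \<Rightarrow> bool" where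
  "lqr_riccati_solution A B X \<longleftrightarrow>
     X \<in> carrier_mat (dim_row A) (dim_row A) \<and> nonneg_mat X \<and>
     X * B * mat_adjoint B * X - X * A - mat_adjoint A * X - 1\<^sub>m (dim_row A)
       = 0\<^sub>m (dim_row A) (dim_row A)"

definition lqr_closed_loop :: "complex mat \<Rightarrow> complex mat \<Rightarrow> complex mat \<Rightarrow> complex mat" where
  "lqr_closed_loop A B X = A - B * (mat_adjoint B * X)"

text \<open>The eigenvalues \<open>\<i> \<lambda>\<^sub>1, \<dots>, \<i> \<lambda>\<^sub>n\<close> of \<open>A\<close> together with an orthonormal family
  \<open>v\<^sub>1, \<dots>, v\<^sub>n\<close> of eigenvectors, indexed by \<open>{1..n}\<close>. Being \<open>n\<close> orthonormal vectors, the
  \<open>v\<^sub>j\<close> form a basis, so each eigenvalue is listed according to its multiplicity.\<close>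

definition ordered_eigenbasis ::
    "nat \<Rightarrow> complex mat \<Rightarrow> (nat \<Rightarrow> real) \<Rightarrow> (nat \<Rightarrow> complex vec) \<Rightarrow> bool" where
  "ordered_eigenbasis n A l v \<longleftrightarrow>
     (\<forall>j \<in> {1..n}. \<forall>k \<in> {1..n}. j \<le> k \<longrightarrow> l j \<le> l k) \<and>
     (\<forall>j \<in> {1..n}. v j \<in> carrier_vec n) \<and>
     (\<forall>j \<in> {1..n}. \<forall>k \<in> {1..n}.
        scalar_prod (v j) (conjugate (v k)) = (if j = k then 1 else 0)) \<and>
     (\<forall>j \<in> {1..n}. A *\<^sub>v v j = (\<i> * complex_of_real (l j)) \<cdot>\<^sub>v v j)"

definition spectral_gap :: "nat \<Rightarrow> (nat \<Rightarrow> real) \<Rightarrow> nat \<Rightarrow> real" where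
  "spectral_gap n l k = Min ((\<lambda>j. \<bar>l j - l k\<bar>) ` ({1..n} - {k}))"

definition rho ::
    "nat \<Rightarrow> complex mat \<Rightarrow> (nat \<Rightarrow> real) \<Rightarrow> (nat \<Rightarrow> complex vec) \<Rightarrow> nat \<Rightarrow> real" where
  "rho n B l v k =
     (if spectral_gap n l k = 0 then 0
      else vec_norm (mat_adjoint B *\<^sub>v v k)
             / (1 + 2 * ((op_norm B)\<^sup>2 / (spectral_gap n l k)\<^sup>2)))"

definition rho1 ::
    "nat \<Rightarrow> complex mat \<Rightarrow> (nat \<Rightarrow> real) \<Rightarrow> (nat \<Rightarrow> complex vec) \<Rightarrow> nat \<Rightarrow> real" where
  "rho1 n B l v k =
     (if spectral_gap n l k = 0 then 0
      else vec_norm (mat_adjoint B *\<^sub>v v k)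
             / sqrt (1 + 2 * ((op_norm B)\<^sup>2 / (spectral_gap n l k)\<^sup>2)))"

definition right_triangle :: "(nat \<Rightarrow> real) \<Rightarrow> nat \<Rightarrow> complex set" where
  "right_triangle l k = convex hull
     {Complex 0 (l k), Complex 0 (l (k + 1)),
      Complex (- (l (k + 1) - l k) / 2) ((l (k + 1) + l k) / 2)}"

definition complex_box :: "real set \<Rightarrow> real set \<Rightarrow> complex set" where
  "complex_box I J = {z. Re z \<in> I \<and> Im z \<in> J}"

definition eigenvalue_count :: "complex mat \<Rightarrow> complex set \<Rightarrow> nat" where
  "eigenvalue_count M S = (\<Sum>\<mu> \<in> spectrum M \<inter> S. Polynomial.order \<mu> (char_poly M))"

end

theory Submission
  imports Defs
begin

text \<open>
  Put \<open>Y = X\<^sup>-\<^sup>1\<close>. The Riccati equation becomes \<open>B B\<^sup>* = Y\<^sup>2 + A Y - Y A\<close>, and the closed-loop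
  matrix is similar to \<open>A - Y\<close>. An eigenvector \<open>(A - Y) y = \<mu> y\<close> therefore satisfies
  \<open>(A - \<mu>)\<^sup>2 y = B B\<^sup>* y\<close>. Expanding \<open>y\<close> in the eigenbasis of \<open>A\<close> with weights
  \<open>p\<^sub>j = |\<langle>y, v\<^sub>j\<rangle>|\<^sup>2\<close> and writing \<open>\<mu> = - a + \<i> b\<close>, this says that \<open>b\<close> is the mean of the
  \<open>\<lambda>\<^sub>j\<close> and that \<open>\<parallel>B\<^sup>* y\<parallel>\<^sup>2 = \<Sum> p\<^sub>j (a\<^sup>2 - (\<lambda>\<^sub>j - b)\<^sup>2)\<close>; the location results are consequences.

  The eigenvalues are counted by inertia. With \<open>\<sigma> = 2 \<surd>2 h\<close> and \<open>t = 3 h / 2\<close>, the Hermitian form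
  \<open>K = t - Y\<close> satisfies \<open>Re \<langle>K y, (A - Y + t) y\<rangle> > 0\<close>, so \<open>K\<close> is negative (positive) definite on
  the invariant subspace of \<open>A - Y\<close> for the eigenvalues left (right) of the line \<open>Re z = - t\<close>.
  Since \<open>K\<close> is positive on \<open>ker B\<^sup>*\<close>, the first subspace has dimension at most \<open>m\<close>. Since
  \<open>\<parallel>Y y\<parallel> \<ge> 2 h \<parallel>y\<parallel>\<close> on the range of \<open>B\<close>, at most \<open>n - m\<close> eigenvalues of \<open>Y\<close> lie below \<open>t\<close>, and
  this bounds the dimension of the second.
\<close>

section \<open>Inner products and norms of complex vectors\<close>

text \<open>The sum runs over the dimension of the left argument, so additivity in that argument
  holds for any \<open>y\<close>. On a common carrier this is \<open>\<bullet>c\<close>.\<close>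

definition ip :: "complex vec \<Rightarrow> complex vec \<Rightarrow> complex" where
  "ip x y = (\<Sum>i<dim_vec x. x $ i * cnj (y $ i))"

lemma ip_cscalar: "x \<in> carrier_vec n \<Longrightarrow> y \<in> carrier_vec n \<Longrightarrow> ip x y = x \<bullet>c y"
  by (simp add: ip_def scalar_prod_def atLeast0LessThan)

lemma ip_add_left: "x \<in> carrier_vec n \<Longrightarrow> z \<in> carrier_vec n \<Longrightarrow> ip (x + z) y = ip x y + ip z y"
  by (simp add: ip_def sum.distrib distrib_right)

lemma ip_diff_left: "x \<in> carrier_vec n \<Longrightarrow> z \<in> carrier_vec n \<Longrightarrow> ip (x - z) y = ip x y - ip z y"
  by (simp add: ip_def sum_subtractf left_diff_distrib)

lemma ip_smult_left: "ip (c \<cdot>\<^sub>v x) y = c * ip x y"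
  by (simp add: ip_def sum_distrib_left mult.assoc)

lemma cnj_ip: "x \<in> carrier_vec n \<Longrightarrow> y \<in> carrier_vec n \<Longrightarrow> cnj (ip x y) = ip y x"
  by (simp add: ip_def mult.commute)

lemma ip_add_right:
  "x \<in> carrier_vec n \<Longrightarrow> y \<in> carrier_vec n \<Longrightarrow> z \<in> carrier_vec n \<Longrightarrow> ip x (y + z) = ip x y + ip x z"
  by (simp add: ip_def sum.distrib distrib_left)

lemma ip_diff_right:
  "x \<in> carrier_vec n \<Longrightarrow> y \<in> carrier_vec n \<Longrightarrow> z \<in> carrier_vec n \<Longrightarrow> ip x (y - z) = ip x y - ip x z"
  by (simp add: ip_def sum_subtractf right_diff_distrib)

lemma ip_smult_right:
  "x \<in> carrier_vec n \<Longrightarrow> y \<in> carrier_vec n \<Longrightarrow> ip x (c \<cdot>\<^sub>v y) = cnj c * ip x y"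
  by (simp add: ip_def sum_distrib_left mult_ac)

lemma ip_zero_right [simp]: "x \<in> carrier_vec n \<Longrightarrow> ip x (0\<^sub>v n) = 0"
  by (simp add: ip_def)

lemma Re_ip_commute: "x \<in> carrier_vec n \<Longrightarrow> y \<in> carrier_vec n \<Longrightarrow> Re (ip x y) = Re (ip y x)"
  using cnj_ip[of x n y, symmetric] by simp

section \<open>Adjoint matrices\<close>

lemma dim_mat_adjoint [simp]:
  "dim_row (mat_adjoint M) = dim_col M" "dim_col (mat_adjoint M) = dim_row M"
  by (auto simp: mat_adjoint_def)

lemma mat_adjoint_carrier [simp]: "M \<in> carrier_mat n m \<Longrightarrow> mat_adjoint M \<in> carrier_mat m n"
  by (intro carrier_matI) (auto simp: mat_adjoint_def)

lemma mat_adjoint_index: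
  "M \<in> carrier_mat n m \<Longrightarrow> i < m \<Longrightarrow> j < n \<Longrightarrow> mat_adjoint M $$ (i, j) = cnj (M $$ (j, i) :: complex)"
  by (auto simp: mat_adjoint_def mat_of_rows_index)

lemma mat_adjoint_adjoint:
  assumes "M \<in> carrier_mat n m"
  shows "mat_adjoint (mat_adjoint M) = (M :: complex mat)"
proof (rule eq_matI)
  have adj: "mat_adjoint (mat_adjoint M) \<in> carrier_mat n m"
    using assms by auto
  then show "dim_row (mat_adjoint (mat_adjoint M)) = dim_row M"
    "dim_col (mat_adjoint (mat_adjoint M)) = dim_col M"
    using assms by auto
  fix i j assume "i < dim_row M" "j < dim_col M"
  then have ij: "i < n" "j < m" using assms by auto
  show "mat_adjoint (mat_adjoint M) $$ (i, j) = M $$ (i, j)"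
    using assms ij by (simp add: mat_adjoint_index[where n = m and m = n] mat_adjoint_index[where n = n and m = m])
qed

lemma ip_adjoint:
  assumes "M \<in> carrier_mat n m" "x \<in> carrier_vec m" "y \<in> carrier_vec n"
  shows "ip (M *\<^sub>v x) y = ip x (mat_adjoint M *\<^sub>v y)"
proof -
  have "ip (M *\<^sub>v x) y = (\<Sum>i<n. \<Sum>j<m. M $$ (i, j) * x $ j * cnj (y $ i))"
    using assms by (simp add: ip_def scalar_prod_def atLeast0LessThan sum_distrib_right)
  also have "\<dots> = (\<Sum>j<m. \<Sum>i<n. M $$ (i, j) * x $ j * cnj (y $ i))"
    by (rule sum.swap)
  also have "\<dots> = ip x (mat_adjoint M *\<^sub>v y)"
    using assms mat_adjoint_carrier[OF assms(1)]
    by (simp add: ip_def scalar_prod_def atLeast0LessThan sum_distrib_left mat_adjoint_index mult_ac)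
  finally show ?thesis .
qed

section \<open>Euclidean norm: Cauchy-Schwarz and triangle inequalities\<close>

lemma vec_norm_L2_set: "vec_norm v = L2_set (\<lambda>i. cmod (v $ i)) {..<dim_vec v}"
  by (simp add: vec_norm_def L2_set_def)

lemma vec_norm_nonneg [simp]: "0 \<le> vec_norm v"
  by (simp add: vec_norm_L2_set)

lemma ip_self: "ip x x = of_real ((vec_norm x)\<^sup>2)"
  by (simp add: ip_def vec_norm_def sum_nonneg complex_norm_square[symmetric])

lemma vec_norm_eq_0_iff: "x \<in> carrier_vec n \<Longrightarrow> vec_norm x = 0 \<longleftrightarrow> x = 0\<^sub>v n"
  by (auto simp: vec_norm_L2_set L2_set_eq_0_iff intro!: eq_vecI)

lemma vec_norm_pos_iff: "x \<in> carrier_vec n \<Longrightarrow> 0 < vec_norm x \<longleftrightarrow> x \<noteq> 0\<^sub>v n"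
  using vec_norm_eq_0_iff[of x n] vec_norm_nonneg[of x] by linarith

lemma norm_ip_le:
  assumes "x \<in> carrier_vec n" "y \<in> carrier_vec n"
  shows "cmod (ip x y) \<le> vec_norm x * vec_norm y"
proof -
  have "cmod (ip x y) \<le> (\<Sum>i<n. \<bar>cmod (x $ i)\<bar> * \<bar>cmod (y $ i)\<bar>)"
    using assms by (auto simp: ip_def norm_mult intro!: sum_norm_le)
  also have "\<dots> \<le> vec_norm x * vec_norm y"
    using L2_set_mult_ineq[of "\<lambda>i. cmod (x $ i)" "\<lambda>i. cmod (y $ i)" "{..<n}"] assms
    by (auto simp: vec_norm_L2_set)
  finally show ?thesis .
qed

lemma Re_ip_le:
  assumes "x \<in> carrier_vec n" "y \<in> carrier_vec n"
  shows "Re (ip x y) \<le> vec_norm x * vec_norm y"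
  using norm_ip_le[OF assms] complex_Re_le_cmod order_trans by blast

lemma vec_norm_smult: "vec_norm (c \<cdot>\<^sub>v x) = cmod c * vec_norm x"
  by (auto simp: vec_norm_L2_set norm_mult L2_set_right_distrib intro!: L2_set_cong)

lemma vec_norm_triangle:
  assumes "x \<in> carrier_vec n" "y \<in> carrier_vec n"
  shows "vec_norm (x + y) \<le> vec_norm x + vec_norm y"
proof -
  have "vec_norm (x + y) \<le> L2_set (\<lambda>i. cmod (x $ i) + cmod (y $ i)) {..<n}"
    unfolding vec_norm_L2_set using assms by (auto intro!: L2_set_mono norm_triangle_ineq)
  also have "\<dots> \<le> vec_norm x + vec_norm y"
    unfolding vec_norm_L2_set using assms by (auto intro: L2_set_triangle_ineq)
  finally show ?thesis .
qed

lemma vec_norm_diff_sq: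
  assumes "x \<in> carrier_vec n" "y \<in> carrier_vec n"
  shows "(vec_norm (x - y))\<^sup>2 = (vec_norm x)\<^sup>2 - 2 * Re (ip x y) + (vec_norm y)\<^sup>2"
proof -
  have "(vec_norm (x - y))\<^sup>2 = Re (ip (x - y) (x - y))"
    by (simp add: ip_self)
  also have "\<dots> = Re (ip x x) - Re (ip x y) - Re (ip y x) + Re (ip y y)"
    using assms by (simp add: ip_diff_left[of _ n] ip_diff_right[of _ n])
  finally show ?thesis
    using Re_ip_commute[OF assms] by (simp add: ip_self)
qed

lemma vec_norm_minus_commute:
  assumes "x \<in> carrier_vec n" "y \<in> carrier_vec n"
  shows "vec_norm (x - y) = vec_norm (y - x)"
proof -
  have "(vec_norm (x - y))\<^sup>2 = (vec_norm (y - x))\<^sup>2"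
    using assms Re_ip_commute[OF assms] by (simp add: vec_norm_diff_sq[of _ n])
  then show ?thesis by simp
qed

lemma vec_norm_triangle_diff:
  assumes "x \<in> carrier_vec n" "y \<in> carrier_vec n"
  shows "vec_norm x \<le> vec_norm (x - y) + vec_norm y"
proof -
  have "x = (x - y) + y" using assms by auto
  then show ?thesis
    using vec_norm_triangle[of "x - y" n y] assms by auto
qed

lemma vec_norm_triangle_sub:
  assumes "x \<in> carrier_vec n" "y \<in> carrier_vec n"
  shows "vec_norm (x - y) \<le> vec_norm x + vec_norm y"
proof -
  have "x - y = x + (- 1) \<cdot>\<^sub>v y"
    using assms by (intro eq_vecI) auto
  then show ?thesis
    using vec_norm_triangle[of x n "(- 1) \<cdot>\<^sub>v y"] assms by (simp add: vec_norm_smult)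
qed

section \<open>Operator norm of a matrix and of its adjoint\<close>

lemma vec_norm_mult_le:
  assumes "M \<in> carrier_mat n m" "x \<in> carrier_vec m"
  shows "vec_norm (M *\<^sub>v x) \<le> (\<Sum>i<n. vec_norm (row M i)) * vec_norm x"
proof -
  have "vec_norm (M *\<^sub>v x) \<le> (\<Sum>i<n. cmod ((M *\<^sub>v x) $ i))"
    using L2_set_le_sum[of "{..<n}" "\<lambda>i. cmod ((M *\<^sub>v x) $ i)"] assms
    by (simp add: vec_norm_L2_set)
  also have "\<dots> \<le> (\<Sum>i<n. vec_norm (row M i) * vec_norm x)"
  proof (rule sum_mono)
    fix i assume "i \<in> {..<n}"
    then have "(M *\<^sub>v x) $ i = ip (row M i) (conjugate x)"
      using assms by (subst ip_cscalar[of _ m]) auto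
    moreover have "vec_norm (conjugate x) = vec_norm x"
      by (simp add: vec_norm_def)
    ultimately show "cmod ((M *\<^sub>v x) $ i) \<le> vec_norm (row M i) * vec_norm x"
      using norm_ip_le[of "row M i" m "conjugate x"] assms by auto
  qed
  finally show ?thesis by (simp add: sum_distrib_right)
qed

text \<open>A supremum over an unbounded set of reals would be unspecified; the crude row-norm bound
  rules this out for \<open>op_norm\<close>.\<close>

lemma op_norm_bdd_above:
  assumes M: "M \<in> carrier_mat n m"
  shows "bdd_above ((\<lambda>x. vec_norm (M *\<^sub>v x)) ` {x \<in> carrier_vec (dim_col M). vec_norm x \<le> 1})"
proof (rule bdd_aboveI2)
  fix w assume "w \<in> {x \<in> carrier_vec (dim_col M). vec_norm x \<le> 1}"
  then have w: "w \<in> carrier_vec m" "vec_norm w \<le> 1" using M by auto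
  have "0 \<le> (\<Sum>i<n. vec_norm (row M i))" by (simp add: sum_nonneg)
  then show "vec_norm (M *\<^sub>v w) \<le> (\<Sum>i<n. vec_norm (row M i))"
    using vec_norm_mult_le[OF M w(1)] w(2) mult_left_le order_trans by blast
qed

lemma vec_norm_mult_op_norm:
  assumes M: "M \<in> carrier_mat n m" and x: "x \<in> carrier_vec m"
  shows "vec_norm (M *\<^sub>v x) \<le> op_norm M * vec_norm x"
proof (cases "x = 0\<^sub>v m")
  case True
  then have "M *\<^sub>v x = 0\<^sub>v n" using M by auto
  then show ?thesis using True by (simp add: vec_norm_def)
next
  case False
  then have pos: "0 < vec_norm x" using vec_norm_pos_iff[OF x] by simp
  let ?S = "{x \<in> carrier_vec (dim_col M). vec_norm x \<le> 1}"
  let ?u = "of_real (1 / vec_norm x) \<cdot>\<^sub>v x"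
  have u: "?u \<in> ?S" using M x pos by (simp add: vec_norm_smult norm_divide)
  have "vec_norm (M *\<^sub>v ?u) \<le> op_norm M"
    unfolding op_norm_def by (rule cSUP_upper2[OF op_norm_bdd_above[OF M] u]) simp
  moreover have "M *\<^sub>v ?u = of_real (1 / vec_norm x) \<cdot>\<^sub>v (M *\<^sub>v x)"
    using M x by (rule mult_mat_vec)
  ultimately show ?thesis
    using pos by (simp add: vec_norm_smult norm_divide divide_le_eq)
qed

lemma op_norm_nonneg:
  assumes M: "M \<in> carrier_mat n m"
  shows "0 \<le> op_norm M"
proof -
  let ?S = "{x \<in> carrier_vec (dim_col M). vec_norm x \<le> 1}"
  have "0\<^sub>v m \<in> ?S" using M by (simp add: vec_norm_def)
  then show ?thesis
    unfolding op_norm_def by (rule cSUP_upper2[OF op_norm_bdd_above[OF M]]) simp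
qed

text \<open>With \<open>w = M\<^sup>* y\<close> one has \<open>\<parallel>w\<parallel>\<^sup>2 =
  \<langle>M w, y\<rangle> \<le> \<parallel>M\<parallel> \<parallel>w\<parallel>
  \<parallel>y\<parallel>\<close>, and a factor \<open>\<parallel>w\<parallel>\<close>
  cancels.\<close>

lemma vec_norm_adjoint_op_norm:
  assumes M: "M \<in> carrier_mat n m" and y: "y \<in> carrier_vec n"
  shows "vec_norm (mat_adjoint M *\<^sub>v y) \<le> op_norm M * vec_norm y"
proof -
  let ?w = "mat_adjoint M *\<^sub>v y"
  have w: "?w \<in> carrier_vec m" using mat_adjoint_carrier[OF M] y by auto
  have "(vec_norm ?w)\<^sup>2 = Re (ip ?w ?w)" by (simp add: ip_self)
  also have "\<dots> = Re (ip (M *\<^sub>v ?w) y)" using ip_adjoint[OF M w y] by simp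
  also have "\<dots> \<le> vec_norm (M *\<^sub>v ?w) * vec_norm y"
    using M w y by (intro Re_ip_le[of _ n]) auto
  also have "\<dots> \<le> (op_norm M * vec_norm ?w) * vec_norm y"
    by (intro mult_right_mono vec_norm_mult_op_norm[OF M w]) simp
  finally have "vec_norm ?w * vec_norm ?w \<le> vec_norm ?w * (op_norm M * vec_norm y)"
    by (simp add: power2_eq_square mult_ac)
  then show ?thesis
    using op_norm_nonneg[OF M] vec_norm_nonneg[of ?w]
    by (cases "vec_norm ?w = 0") (auto simp: mult_le_cancel_left)
qed

section \<open>Kernels and intersections by dimension count\<close>

lemma wide_mat_kernel:
  fixes C :: "complex mat"
  assumes C: "C \<in> carrier_mat n k" and "n < k"
  shows "\<exists>w \<in> carrier_vec k. w \<noteq> 0\<^sub>v k \<and> C *\<^sub>v w = 0\<^sub>v n"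
proof -
  \<comment> \<open>Padding with zero rows makes \<open>C\<close> square, so that a determinant
    decides whether the kernel is trivial.\<close>
  define D where "D = mat k k (\<lambda>(i, j). if i < n then C $$ (i, j) else 0)"
  have D: "D \<in> carrier_mat k k" by (simp add: D_def)
  \<comment> \<open>Row \<open>n\<close> of \<open>D\<close> is the first added zero row, so the
    transpose annihilates the corresponding unit vector.\<close>
  have "transpose_mat D *\<^sub>v unit_vec k n = 0\<^sub>v k"
    using \<open>n < k\<close> by (intro eq_vecI) (auto simp: D_def)
  then have "det (transpose_mat D) = 0"
    using \<open>n < k\<close> D by (subst det_0_iff_vec_prod_zero[of _ k]) (auto intro!: exI[of _ "unit_vec k n"])
  then have "det D = 0" using det_transpose[OF D] by simp
  then obtain w where w: "w \<in> carrier_vec k" "w \<noteq> 0\<^sub>v k" "D *\<^sub>v w = 0\<^sub>v k"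
    using det_0_iff_vec_prod_zero[OF D] by blast
  have "C *\<^sub>v w = 0\<^sub>v n"
  proof (rule eq_vecI)
    fix i assume "i < dim_vec (0\<^sub>v n :: complex vec)"
    then have i: "i < n" by simp
    then have "(C *\<^sub>v w) $ i = (D *\<^sub>v w) $ i"
      using C w(1) \<open>n < k\<close> by (auto simp: D_def scalar_prod_def)
    then show "(C *\<^sub>v w) $ i = 0\<^sub>v n $ i" using w(3) i \<open>n < k\<close> by simp
  qed (use C in auto)
  then show ?thesis using w by blast
qed

text \<open>The block matrix \<open>[U, -V]\<close> has more columns than rows, hence a nonzero
  kernel vector \<open>(u, w)\<close>. Injectivity of \<open>U\<close> and \<open>V\<close> is not
  assumed, so which of \<open>u\<close> and \<open>w\<close> is nonzero is settled at each
  use.\<close>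

lemma ranges_intersect:
  fixes U V :: "complex mat"
  assumes U: "U \<in> carrier_mat n p" and V: "V \<in> carrier_mat n q" and "n < p + q"
  shows "\<exists>u \<in> carrier_vec p. \<exists>w \<in> carrier_vec q.
    (u \<noteq> 0\<^sub>v p \<or> w \<noteq> 0\<^sub>v q) \<and> U *\<^sub>v u = V *\<^sub>v w"
proof -
  define C where "C = mat n (p + q) (\<lambda>(i, j). if j < p then U $$ (i, j) else - V $$ (i, j - p))"
  have "C \<in> carrier_mat n (p + q)" by (simp add: C_def)
  from wide_mat_kernel[OF this \<open>n < p + q\<close>] obtain z where
    z: "z \<in> carrier_vec (p + q)" "z \<noteq> 0\<^sub>v (p + q)" "C *\<^sub>v z = 0\<^sub>v n" by blast
  define u where "u = vec p (\<lambda>j. z $ j)"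
  define w where "w = vec q (\<lambda>j. z $ (j + p))"
  have "U *\<^sub>v u = V *\<^sub>v w"
  proof (rule eq_vecI)
    fix i assume "i < dim_vec (V *\<^sub>v w)"
    then have i: "i < n" using V by auto
    have "(C *\<^sub>v z) $ i = (\<Sum>j\<in>{0..<p + q}. (if j < p then U $$ (i, j) else - V $$ (i, j - p)) * z $ j)"
      using z(1) i by (simp add: C_def scalar_prod_def)
    also have "\<dots> = (\<Sum>j\<in>{0..<p}. U $$ (i, j) * z $ j) + (\<Sum>j\<in>{p..<p + q}. - V $$ (i, j - p) * z $ j)"
      by (subst sum.atLeastLessThan_concat[symmetric, of 0 p]) auto
    also have "(\<Sum>j\<in>{p..<p + q}. - V $$ (i, j - p) * z $ j) = (\<Sum>j\<in>{0..<q}. - V $$ (i, j) * z $ (j + p))"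
      using sum.shift_bounds_nat_ivl[of "\<lambda>j. - V $$ (i, j - p) * z $ j" 0 p q] by (simp add: add.commute)
    finally show "(U *\<^sub>v u) $ i = (V *\<^sub>v w) $ i"
      using z(3) i U V by (simp add: u_def w_def scalar_prod_def sum_negf)
  qed (use U V in auto)
  moreover have "u \<noteq> 0\<^sub>v p \<or> w \<noteq> 0\<^sub>v q"
  proof (rule ccontr)
    assume "\<not> ?thesis"
    then have a: "u = 0\<^sub>v p" "w = 0\<^sub>v q" by auto
    have "z = 0\<^sub>v (p + q)"
    proof (rule eq_vecI)
      fix i assume "i < dim_vec (0\<^sub>v (p + q) :: complex vec)"
      then have i: "i < p + q" by simp
      show "z $ i = 0\<^sub>v (p + q) $ i"
      proof (cases "i < p")
        case True
        then have "z $ i = u $ i" by (simp add: u_def)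
        then show ?thesis using True a by simp
      next
        case False
        then have "i - p + p = i" by simp
        then have "z $ i = w $ (i - p)" using i False by (simp add: w_def)
        then show ?thesis using False a i by simp
      qed
    qed (use z in auto)
    then show False using z(2) by simp
  qed
  ultimately show ?thesis by (intro bexI[of _ u] bexI[of _ w]) (auto simp: u_def w_def)
qed

section \<open>Inertia\<close>

text \<open>
  Gram--Schmidt with respect to \<open>h\<close> along the standard flag, which \<open>T\<close> preserves: the \<open>i\<close>-th vector
  \<open>u\<close> satisfies \<open>T u + t u = (T\<^sub>i\<^sub>i + t) u + r\<close> with \<open>r\<close> orthogonal to \<open>u\<close>, so that \<open>h u u\<close> has the
  sign of \<open>Re T\<^sub>i\<^sub>i + t\<close>.
\<close>

lemma flag_form_negative:
  fixes T :: "complex mat" and h :: "complex vec \<Rightarrow> complex vec \<Rightarrow> complex" and t :: real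
  assumes T: "T \<in> carrier_mat n n" "upper_triangular T"
    and add: "\<And>x y z. \<lbrakk>x \<in> carrier_vec n; y \<in> carrier_vec n; z \<in> carrier_vec n\<rbrakk> \<Longrightarrow> h (x + y) z = h x z + h y z"
    and smult: "\<And>c x z. \<lbrakk>x \<in> carrier_vec n; z \<in> carrier_vec n\<rbrakk> \<Longrightarrow> h (c \<cdot>\<^sub>v x) z = c * h x z"
    and herm: "\<And>x z. \<lbrakk>x \<in> carrier_vec n; z \<in> carrier_vec n\<rbrakk> \<Longrightarrow> h z x = cnj (h x z)"
    and pos: "\<And>x. \<lbrakk>x \<in> carrier_vec n; x \<noteq> 0\<^sub>v n\<rbrakk> \<Longrightarrow> 0 < Re (h x (T *\<^sub>v x + of_real t \<cdot>\<^sub>v x))"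
    and q: "q \<le> n" "\<And>i. i < q \<Longrightarrow> Re (T $$ (i, i)) + t < 0"
    and x: "x \<in> carrier_vec n" "x \<noteq> 0\<^sub>v n" "\<And>j. q \<le> j \<Longrightarrow> j < n \<Longrightarrow> x $ j = 0"
  shows "Re (h x x) < 0"
proof -
  \<comment> \<open>\<open>supp k\<close> is the span of the first \<open>k\<close> unit vectors,
    the \<open>k\<close>-th space of the flag.\<close>
  define supp where "supp k x \<longleftrightarrow> x \<in> carrier_vec n \<and> (\<forall>j<n. k \<le> j \<longrightarrow> x $ j = 0)" for k :: nat and x :: "complex vec"
  have addr: "h z (x + y) = h z x + h z y"
    if "x \<in> carrier_vec n" "y \<in> carrier_vec n" "z \<in> carrier_vec n" for x y z
    using that add[OF that] herm[of _ z] by (metis add_carrier_vec complex_cnj_add)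
  have smultr: "h z (c \<cdot>\<^sub>v x) = cnj c * h z x"
    if "x \<in> carrier_vec n" "z \<in> carrier_vec n" for c x z
    using that smult[OF that] herm[of _ z] by (metis smult_carrier_vec complex_cnj_mult)
  \<comment> \<open>The vector \<open>u\<close> extends level \<open>i\<close> of the flag to level
    \<open>i + 1\<close>, is \<open>h\<close>-negative and \<open>h\<close>-orthogonal to all of
    level \<open>i\<close>, and is scaled so that \<open>split\<close> can subtract the
    coordinate.\<close>
  define Q where "Q i u \<longleftrightarrow> supp (Suc i) u \<and> u $ i = 1 \<and> Re (h u u) < 0 \<and>
    (\<forall>x. supp i x \<longrightarrow> h x u = 0)" for i u
  have split: "\<exists>x'. supp k x' \<and> x = x' + (x $ k) \<cdot>\<^sub>v u"
    if "supp (Suc k) x" "Q k u" "k < n" for k x u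
  proof (intro exI conjI)
    have c: "x \<in> carrier_vec n" "u \<in> carrier_vec n" using that by (auto simp: Q_def supp_def)
    then show "x = (x - (x $ k) \<cdot>\<^sub>v u) + (x $ k) \<cdot>\<^sub>v u" by auto
    show "supp k (x - (x $ k) \<cdot>\<^sub>v u)"
      unfolding supp_def
    proof (intro conjI allI impI)
      fix j assume "j < n" "k \<le> j"
      then show "(x - x $ k \<cdot>\<^sub>v u) $ j = 0"
        using that c by (cases "j = k") (auto simp: Q_def supp_def)
    qed (use c in auto)
  qed
  have Q: "\<exists>u. Q i u" if "i < q" for i
    using that
  proof (induction i rule: less_induct)
    case (less i)
    then have "\<forall>j. \<exists>u. j < i \<longrightarrow> Q j u" by auto
    then obtain us where us: "\<And>j. j < i \<Longrightarrow> Q j (us j)" by metis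
    have i: "i < n" using less.prems q by simp
    have usc: "us j \<in> carrier_vec n" if "j < i" for j
      using us[OF that] by (simp add: Q_def supp_def)
    \<comment> \<open>Orthogonalise the \<open>i\<close>-th unit vector against \<open>us 0\<close>,
      \<open>us 1\<close>, ... in turn. The form may be indefinite, but each
      \<open>h (us k) (us k)\<close> is negative by the outer induction, so the division is
      legitimate.\<close>
    have "\<exists>w. supp (Suc i) w \<and> w $ i = 1 \<and> (\<forall>j<k. h (us j) w = 0)" if "k \<le> i" for k
      using that
    proof (induction k)
      case 0
      show ?case using i by (intro exI[of _ "unit_vec n i"]) (auto simp: supp_def)
    next
      case (Suc k)
      then obtain w where w: "supp (Suc i) w" "w $ i = 1" "\<forall>j<k. h (us j) w = 0" by auto
      define c where "c = cnj (h (us k) w / h (us k) (us k))"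
      have k: "k < i" using Suc by simp
      have nz: "h (us k) (us k) \<noteq> 0" using us[OF k] by (auto simp: Q_def)
      have wc: "w \<in> carrier_vec n" using w by (simp add: supp_def)
      let ?w = "w + (- c) \<cdot>\<^sub>v us k"
      have h: "h (us j) ?w = h (us j) w - cnj c * h (us j) (us k)" if "j < i" for j
        using wc usc[OF that] usc[OF k] by (simp add: addr smultr)
      have "h (us j) ?w = 0" if j: "j < Suc k" for j
      proof (cases "j = k")
        case True
        then show ?thesis using h[OF k] nz by (simp add: c_def)
      next
        case False
        then have "j < k" using j by simp
        moreover from this have "supp k (us j)"
          using us[of j] k by (auto simp: Q_def supp_def)
        ultimately show ?thesis using h[of j] us[OF k] w(3) k by (simp add: Q_def)
      qed
      moreover have "supp (Suc i) ?w" "?w $ i = 1"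
        using w wc usc[OF k] us[OF k] k i by (auto simp: supp_def Q_def)
      ultimately show ?case by blast
    qed
    then obtain w where w: "supp (Suc i) w" "w $ i = 1" "\<And>j. j < i \<Longrightarrow> h (us j) w = 0" by blast
    have wc: "w \<in> carrier_vec n" using w by (simp add: supp_def)
    have w0: "w \<noteq> 0\<^sub>v n" using w(2) i by auto
    \<comment> \<open>The \<open>us j\<close> with \<open>j < k\<close> span level \<open>k\<close>,
      so orthogonality to them passes to the whole level.\<close>
    have orth: "h x w = 0" if "k \<le> i" "supp k x" for k x
      using that
    proof (induction k arbitrary: x)
      case 0
      then have "x = 0 \<cdot>\<^sub>v w" using wc by (intro eq_vecI) (auto simp: supp_def)
      then show ?case using smult[OF wc wc, of 0] by simp
    next
      case (Suc k)
      then obtain x' where x': "supp k x'" "x = x' + (x $ k) \<cdot>\<^sub>v us k"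
        using split[of k x "us k"] us[of k] i by auto
      have c: "x' \<in> carrier_vec n" "us k \<in> carrier_vec n"
        using x'(1) usc Suc.prems by (auto simp: supp_def)
      have "h x w = h x' w + x $ k * h (us k) w"
        by (subst x'(2)) (use c wc in \<open>simp add: add smult\<close>)
      then show ?case using Suc x'(1) w(3)[of k] by simp
    qed
    define e where "e = T $$ (i, i) + of_real t"
    define r where "r = (T *\<^sub>v w + of_real t \<cdot>\<^sub>v w) - e \<cdot>\<^sub>v w"
    have rc: "r \<in> carrier_vec n" using wc T by (auto simp: r_def)
    have "supp i r"
      unfolding supp_def
    proof (intro conjI allI impI rc)
      fix j assume j: "j < n" "i \<le> j"
      have "(T *\<^sub>v w) $ j = (\<Sum>l\<in>{0..<n}. T $$ (j, l) * w $ l)"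
        using T wc j by (simp add: scalar_prod_def)
      \<comment> \<open>In row \<open>j \<ge> i\<close>, entries left of the diagonal vanish by
        triangularity and coordinates of \<open>w\<close> beyond \<open>j\<close> vanish by its
        support.\<close>
      also have "\<dots> = (\<Sum>l\<in>{0..<n}. if l = j then T $$ (j, j) * w $ j else 0)"
      proof (intro sum.cong refl)
        fix l assume "l \<in> {0..<n}"
        then show "T $$ (j, l) * w $ l = (if l = j then T $$ (j, j) * w $ j else 0)"
          using upper_triangularD[OF T(2), of l j] T(1) j w(1)
          by (cases l j rule: linorder_cases) (auto simp: supp_def)
      qed
      also have "\<dots> = T $$ (j, j) * w $ j" using j by simp
      finally have "(T *\<^sub>v w) $ j = T $$ (j, j) * w $ j" .
      then show "r $ j = 0"
        using j w(1,2) wc T by (cases "j = i") (auto simp: r_def e_def supp_def algebra_simps)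
    qed
    then have "h r w = 0" using orth[of i r] by simp
    then have "h w r = 0" using herm[OF rc wc] by simp
    moreover have "T *\<^sub>v w + of_real t \<cdot>\<^sub>v w = e \<cdot>\<^sub>v w + r"
      using wc T by (auto simp: r_def)
    ultimately have "h w (T *\<^sub>v w + of_real t \<cdot>\<^sub>v w) = cnj e * h w w"
      using wc rc by (simp add: addr smultr)
    then have "0 < Re (cnj e * h w w)" using pos[OF wc w0] by simp
    \<comment> \<open>As \<open>h w w\<close> is real, the positive real part factors as
      \<open>Re e * Re (h w w)\<close>, and \<open>Re e < 0\<close> fixes the sign.\<close>
    moreover have "Im (h w w) = 0" using herm[OF wc wc] by (metis complex_cnj_cancel_iff cnj.simps(2) neg_equal_zero)
    ultimately have "0 < Re e * Re (h w w)" by simp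
    moreover have "Re e < 0" using q(2)[OF less.prems] by (simp add: e_def)
    ultimately have "Re (h w w) < 0" by (simp add: zero_less_mult_iff)
    then have "Q i w" using w orth[of i] by (auto simp: Q_def)
    then show ?case by blast
  qed
  \<comment> \<open>Removing the multiple of the top \<open>Q\<close>-vector splits
    \<open>h x x\<close> without cross terms, so negativity climbs from level \<open>k\<close> to
    \<open>k + 1\<close>.\<close>
  have "x = 0\<^sub>v n \<or> Re (h x x) < 0" if "k \<le> q" "supp k x" for k x
    using that
  proof (induction k arbitrary: x)
    case 0
    then have "x = 0\<^sub>v n" by (intro eq_vecI) (auto simp: supp_def)
    then show ?case by simp
  next
    case (Suc k)
    obtain u where u: "Q k u" using Q[of k] Suc.prems by auto
    obtain x' where x': "supp k x'" "x = x' + (x $ k) \<cdot>\<^sub>v u"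
      using split[of k x u] u Suc.prems q by auto
    have c: "x' \<in> carrier_vec n" "u \<in> carrier_vec n"
      using x'(1) u by (auto simp: supp_def Q_def)
    have "h x' u = 0" using u x'(1) by (simp add: Q_def)
    moreover from this have "h u x' = 0" using herm[OF c] by simp
    ultimately have "h x x = h x' x' + x $ k * cnj (x $ k) * h u u"
      by (subst (1 2) x'(2)) (use c in \<open>simp add: add smult addr smultr\<close>)
    then have hx: "Re (h x x) = Re (h x' x') + (cmod (x $ k))\<^sup>2 * Re (h u u)"
      by (simp only: complex_norm_square[symmetric]) simp
    have neg: "Re (h u u) < 0" using u by (simp add: Q_def)
    show ?case
    proof (cases "x $ k = 0")
      case True
      then have "x = x'" using x'(2) c by auto
      then show ?thesis using Suc x'(1) by auto
    next
      case False
      then have "(cmod (x $ k))\<^sup>2 * Re (h u u) < 0" using neg by (simp add: mult_less_0_iff)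
      moreover have "Re (h x' x') \<le> 0"
      proof (cases "x' = 0\<^sub>v n")
        case True
        then have "x' = 0 \<cdot>\<^sub>v u" using c by auto
        then have "h x' x' = 0" using smult[OF c(2) c(1), of 0] by simp
        then show ?thesis by simp
      next
        case False
        then show ?thesis using Suc.IH[OF _ x'(1)] Suc.prems by simp
      qed
      ultimately show ?thesis using hx by simp
    qed
  qed
  from this[of q x] show ?thesis using x by (auto simp: supp_def)
qed

text \<open>Permits listing selected eigenvalues first; the Schur decomposition puts them on the
  diagonal in list order.\<close>

lemma prod_list_filter_split:
  fixes f :: "'a \<Rightarrow> 'b :: comm_monoid_mult"
  shows "prod_list (map f (filter P xs @ filter (\<lambda>x. \<not> P x) xs)) = prod_list (map f xs)"
  by (induction xs) (auto simp: mult_ac)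

lemma smult_mat_mult_vec:
  fixes M :: "'a :: comm_ring mat"
  assumes "M \<in> carrier_mat n m" "x \<in> carrier_vec m"
  shows "(c \<cdot>\<^sub>m M) *\<^sub>v x = c \<cdot>\<^sub>v (M *\<^sub>v x)"
  using assms by (intro eq_vecI) auto

text \<open>The sign \<open>s\<close> selects the eigenvalues to the left or to the right of the line \<open>Re z = - t\<close>.\<close>

lemma inertia_subspace:
  fixes L G :: "complex mat" and s t :: real
  assumes L: "L \<in> carrier_mat n n" "char_poly L = (\<Prod>e\<leftarrow>es. [:- e, 1:])"
    and s: "s\<^sup>2 = 1"
    and r: "r = length (filter (\<lambda>e. s * (Re e + t) < 0) es)"
    and G: "G \<in> carrier_mat n n"
    and herm: "\<And>x y. \<lbrakk>x \<in> carrier_vec n; y \<in> carrier_vec n\<rbrakk> \<Longrightarrow> ip (G *\<^sub>v x) y = ip x (G *\<^sub>v y)"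
    and pos: "\<And>x. \<lbrakk>x \<in> carrier_vec n; x \<noteq> 0\<^sub>v n\<rbrakk> \<Longrightarrow>
      0 < Re (ip (G *\<^sub>v x) (L *\<^sub>v x + of_real t \<cdot>\<^sub>v x))"
  shows "\<exists>W \<in> carrier_mat n r. \<forall>w \<in> carrier_vec r. w \<noteq> 0\<^sub>v r \<longrightarrow>
    W *\<^sub>v w \<noteq> 0\<^sub>v n \<and> s * Re (ip (G *\<^sub>v (W *\<^sub>v w)) (W *\<^sub>v w)) < 0"
proof -
  \<comment> \<open>With the selected eigenvalues in front, the first \<open>r\<close> columns of
    the Schur basis \<open>P\<close> span their invariant subspace.\<close>
  define es' where "es' = filter (\<lambda>e. s * (Re e + t) < 0) es @ filter (\<lambda>e. \<not> s * (Re e + t) < 0) es"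
  have c: "char_poly L = (\<Prod>e\<leftarrow>es'. [:- e, 1:])"
    unfolding es'_def L(2) prod_list_filter_split ..
  obtain T P R where TPR: "schur_decomposition L es' = (T, P, R)"
    by (cases "schur_decomposition L es'") auto
  from schur_decomposition[OF L(1) c TPR] have
    sim: "similar_mat_wit L T P R" and T: "upper_triangular T" and d: "diag_mat T = es'" by auto
  from similar_mat_witD2[OF L(1) sim] have
    PR: "P * R = 1\<^sub>m n" and RP: "R * P = 1\<^sub>m n" and LT: "L = P * T * R"
    and carr: "T \<in> carrier_mat n n" "P \<in> carrier_mat n n" "R \<in> carrier_mat n n" by auto
  have "length es' = n" using d carr by (auto simp: diag_mat_def)
  then have rn: "r \<le> n" by (simp add: r es'_def)
  have LP: "L *\<^sub>v (P *\<^sub>v x) = P *\<^sub>v (T *\<^sub>v x)" if "x \<in> carrier_vec n" for x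
  proof -
    have "L * P = P * T * (R * P)" unfolding LT using carr by (simp add: assoc_mult_mat[of _ n n _ n _ n])
    then have "L * P = P * T" using RP carr by simp
    then show ?thesis using that carr L by (simp flip: assoc_mult_mat_vec)
  qed
  have inj: "P *\<^sub>v x \<noteq> 0\<^sub>v n" if "x \<in> carrier_vec n" "x \<noteq> 0\<^sub>v n" for x
  proof
    assume "P *\<^sub>v x = 0\<^sub>v n"
    then have "R *\<^sub>v (P *\<^sub>v x) = 0\<^sub>v n" using carr by auto
    then show False using that carr RP by (simp flip: assoc_mult_mat_vec)
  qed
  define W where "W = mat n r (\<lambda>(i, j). P $$ (i, j))"
  have W: "W \<in> carrier_mat n r" by (simp add: W_def)
  have neg: "s * Re (ip (G *\<^sub>v (W *\<^sub>v w)) (W *\<^sub>v w)) < 0"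
    if w: "w \<in> carrier_vec r" "w \<noteq> 0\<^sub>v r" for w
  proof -
    define x where "x = vec n (\<lambda>i. if i < r then w $ i else 0)"
    have xc: "x \<in> carrier_vec n" by (simp add: x_def)
    have x0: "x \<noteq> 0\<^sub>v n"
    proof
      assume x0: "x = 0\<^sub>v n"
      have "w = 0\<^sub>v r"
      proof (rule eq_vecI)
        fix i assume "i < dim_vec (0\<^sub>v r :: complex vec)"
        then have "w $ i = x $ i" "i < n" "i < r" using rn by (auto simp: x_def)
        then show "w $ i = 0\<^sub>v r $ i" by (simp add: x0)
      qed (use w in auto)
      then show False using w by simp
    qed
    have Wx: "W *\<^sub>v w = P *\<^sub>v x"
    proof (rule eq_vecI)
      fix i assume "i < dim_vec (P *\<^sub>v x)"
      then have i: "i < n" using carr by simp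
      have "(P *\<^sub>v x) $ i = (\<Sum>j\<in>{0..<n}. P $$ (i, j) * (if j < r then w $ j else 0))"
        using i carr by (simp add: x_def scalar_prod_def)
      also have "\<dots> = (\<Sum>j\<in>{0..<r}. P $$ (i, j) * w $ j)"
        using rn by (intro sum.mono_neutral_cong_right) auto
      finally show "(W *\<^sub>v w) $ i = (P *\<^sub>v x) $ i"
        using i w by (simp add: W_def scalar_prod_def)
    qed (use W carr in auto)
    \<comment> \<open>The form, \<open>T\<close> and \<open>t\<close> are all multiplied by
      \<open>s\<close>. The signs cancel in the positivity hypothesis because
      \<open>s\<^sup>2 = 1\<close>, and the first \<open>r\<close> diagonal entries of
      \<open>s (T + t)\<close> get negative real part.\<close>
    let ?h = "\<lambda>x y. of_real s * ip (G *\<^sub>v (P *\<^sub>v x)) (P *\<^sub>v y)"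
    have "Re (?h x x) < 0"
    proof (rule flag_form_negative[where n = n and h = ?h and T = "of_real s \<cdot>\<^sub>m T" and t = "s * t" and q = r])
      show "of_real s \<cdot>\<^sub>m T \<in> carrier_mat n n" using carr by simp
      show "upper_triangular (of_real s \<cdot>\<^sub>m T)"
        using T carr by (auto simp: upper_triangular_def)
      show "?h (x + y) z = ?h x z + ?h y z"
        if "x \<in> carrier_vec n" "y \<in> carrier_vec n" "z \<in> carrier_vec n" for x y z
        using that carr G by (simp add: mult_add_distrib_mat_vec[of _ n n] ip_add_left[of _ n] distrib_left)
      show "?h (c \<cdot>\<^sub>v x) z = c * ?h x z"
        if "x \<in> carrier_vec n" "z \<in> carrier_vec n" for c x z
        using that carr G by (simp add: mult_mat_vec[of _ n n] ip_smult_left)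
      show "?h z x = cnj (?h x z)"
        if "x \<in> carrier_vec n" "z \<in> carrier_vec n" for x z
        using that carr G herm by (simp add: cnj_ip[of _ n])
      show "0 < Re (?h x (of_real s \<cdot>\<^sub>m T *\<^sub>v x + of_real (s * t) \<cdot>\<^sub>v x))"
        if "x \<in> carrier_vec n" "x \<noteq> 0\<^sub>v n" for x
      proof -
        have "P *\<^sub>v (of_real s \<cdot>\<^sub>m T *\<^sub>v x + of_real (s * t) \<cdot>\<^sub>v x)
          = of_real s \<cdot>\<^sub>v (L *\<^sub>v (P *\<^sub>v x) + of_real t \<cdot>\<^sub>v (P *\<^sub>v x))"
          using that carr L
          by (simp add: LP mult_add_distrib_mat_vec[of _ n n] mult_mat_vec[of _ n n] smult_mat_mult_vec[of _ n n]
              smult_add_distrib_vec[of _ n] smult_smult_assoc)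
        then have "?h x (of_real s \<cdot>\<^sub>m T *\<^sub>v x + of_real (s * t) \<cdot>\<^sub>v x)
          = of_real (s\<^sup>2) * ip (G *\<^sub>v (P *\<^sub>v x)) (L *\<^sub>v (P *\<^sub>v x) + of_real t \<cdot>\<^sub>v (P *\<^sub>v x))"
          using that carr G L by (simp add: ip_smult_right[of _ n] power2_eq_square)
        then show ?thesis
          using pos inj that carr s by simp
      qed
      show "r \<le> n" by (rule rn)
      show "Re ((of_real s \<cdot>\<^sub>m T) $$ (i, i)) + s * t < 0" if "i < r" for i
      proof -
        have "T $$ (i, i) = es' ! i" using that rn carr by (simp flip: d add: diag_mat_def)
        also have "\<dots> = filter (\<lambda>e. s * (Re e + t) < 0) es ! i"
          using that by (simp add: es'_def r nth_append)
        finally have "s * (Re (T $$ (i, i)) + t) < 0"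
          using nth_mem[of i "filter (\<lambda>e. s * (Re e + t) < 0) es"] that by (simp add: r)
        then show ?thesis using that rn carr by (simp add: distrib_left)
      qed
      show "x $ j = 0" if "r \<le> j" "j < n" for j using that by (simp add: x_def)
    qed (rule xc x0)+
    then show ?thesis by (simp add: Wx)
  qed
  moreover have "W *\<^sub>v w \<noteq> 0\<^sub>v n" if "w \<in> carrier_vec r" "w \<noteq> 0\<^sub>v r" for w
    using neg[OF that] mult_mat_vec_carrier[OF G zero_carrier_vec] by auto
  ultimately show ?thesis using W by blast
qed

text \<open>\<open>Polynomial.order\<close> is additive on products, so multiplicity is the number
  of occurrences in the root list.\<close>

lemma eigenvalue_count_eq:
  assumes L: "L \<in> carrier_mat n n" and c: "char_poly L = (\<Prod>e\<leftarrow>es. [:- e, 1:])"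
  shows "eigenvalue_count L S = length (filter (\<lambda>e. e \<in> S) es)"
proof -
  have order: "Polynomial.order e (\<Prod>e\<leftarrow>es. [:- e, 1:]) = count_list es e" for e :: complex and es
  proof (induction es)
    case (Cons a es)
    have "(\<Prod>e\<leftarrow>es. [:- e, 1:]) \<noteq> 0"
      by (auto simp: prod_list_zero_iff)
    then have "[:- a, 1:] * (\<Prod>e\<leftarrow>es. [:- e, 1:]) \<noteq> 0"
      by (metis mult_eq_0_iff one_neq_zero pCons_eq_0_iff)
    then have "Polynomial.order e (\<Prod>e\<leftarrow>a # es. [:- e, 1:])
      = Polynomial.order e [:- a, 1:] + Polynomial.order e (\<Prod>e\<leftarrow>es. [:- e, 1:])"
      by (simp only: list.map prod_list.Cons) (rule order_mult)
    also have "Polynomial.order e [:- a, 1:] = (if a = e then 1 else 0)"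
      using order_power_n_n[of a 1] by (auto simp: order_0I)
    finally show ?case using Cons by simp
  qed (simp add: order_0I)
  have "spectrum L = set es"
    unfolding spectrum_def eigenvalue_root_char_poly[OF L] c
    by (auto simp: poly_prod_list prod_list_zero_iff)
  then have "eigenvalue_count L S = (\<Sum>e\<in>set es \<inter> S. count_list es e)"
    by (simp add: eigenvalue_count_def c order)
  also have "\<dots> = (\<Sum>e\<in>set (filter (\<lambda>e. e \<in> S) es). count_list (filter (\<lambda>e. e \<in> S) es) e)"
  proof (rule sum.cong)
    fix e assume "e \<in> set (filter (\<lambda>e. e \<in> S) es)"
    then have "e \<in> S" by simp
    then show "count_list es e = count_list (filter (\<lambda>e. e \<in> S) es) e"
      by (induction es) auto
  qed auto
  also have "\<dots> = length (filter (\<lambda>e. e \<in> S) es)" by (rule sum_count_set) auto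
  finally show ?thesis .
qed

section \<open>Location of closed-loop eigenvalues\<close>

text \<open>Parseval: the matrix \<open>V\<close> of the eigenvectors satisfies
  \<open>V\<^sup>* V = 1\<close> and, being square, also \<open>V V\<^sup>* = 1\<close>.\<close>

lemma ip_eigenbasis:
  assumes "ordered_eigenbasis n A l v" "x \<in> carrier_vec n" "y \<in> carrier_vec n"
  shows "ip x y = (\<Sum>j\<in>{1..n}. ip x (v j) * cnj (ip y (v j)))"
proof -
  \<comment> \<open>Columns are numbered from 0, the eigenbasis from 1.\<close>
  define V where "V = mat n n (\<lambda>(i, j). v (Suc j) $ i)"
  have V: "V \<in> carrier_mat n n" by (simp add: V_def)
  have Vi: "V $$ (i, j) = v (Suc j) $ i" if "i < n" "j < n" for i j
    using that by (simp add: V_def)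
  have vc: "v j \<in> carrier_vec n" if "j \<in> {1..n}" for j
    using assms(1) that by (simp add: ordered_eigenbasis_def)
  have coef: "(mat_adjoint V *\<^sub>v z) $ j = ip z (v (Suc j))" if "j < n" "z \<in> carrier_vec n" for j z
    using that V by (simp add: scalar_prod_def ip_def mat_adjoint_index[OF V] atLeast0LessThan Vi mult.commute)
  have "mat_adjoint V * V = 1\<^sub>m n"
  proof (rule eq_matI)
    fix i j assume "i < dim_row (1\<^sub>m n :: complex mat)" "j < dim_col (1\<^sub>m n :: complex mat)"
    then have ij: "i < n" "j < n" by auto
    have "(mat_adjoint V * V) $$ (i, j) = (\<Sum>k<n. v (Suc j) $ k * cnj (v (Suc i) $ k))"
      using ij V by (simp add: scalar_prod_def mat_adjoint_index[OF V] atLeast0LessThan Vi mult.commute)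
    also have "\<dots> = v (Suc j) \<bullet>c v (Suc i)"
      using vc[of "Suc i"] vc[of "Suc j"] ij by (simp add: scalar_prod_def atLeast0LessThan)
    finally show "(mat_adjoint V * V) $$ (i, j) = 1\<^sub>m n $$ (i, j)"
      using assms(1) ij by (auto simp: ordered_eigenbasis_def)
  qed (use V in auto)
  then have VV: "V * mat_adjoint V = 1\<^sub>m n"
    using mat_mult_left_right_inverse[of "mat_adjoint V" n V] V by simp
  have "ip x y = ip (V *\<^sub>v (mat_adjoint V *\<^sub>v x)) y"
    using assoc_mult_mat_vec[OF V mat_adjoint_carrier[OF V] assms(2)] VV assms(2) by simp
  also have "\<dots> = ip (mat_adjoint V *\<^sub>v x) (mat_adjoint V *\<^sub>v y)"
    using assms by (intro ip_adjoint[OF V] mult_mat_vec_carrier[OF mat_adjoint_carrier[OF V]])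
  also have "\<dots> = (\<Sum>j<n. ip x (v (Suc j)) * cnj (ip y (v (Suc j))))"
    using V assms coef by (auto simp: ip_def[of "mat_adjoint V *\<^sub>v x"] simp del: index_mult_mat_vec)
  also have "\<dots> = (\<Sum>j\<in>{1..n}. ip x (v j) * cnj (ip y (v j)))"
    by (rule sum.reindex_bij_witness[of _ "\<lambda>j. j - 1" Suc]) auto
  finally show ?thesis .
qed

lemma vec_norm_eigenbasis:
  assumes "ordered_eigenbasis n A l v" "x \<in> carrier_vec n"
  shows "(vec_norm x)\<^sup>2 = (\<Sum>j\<in>{1..n}. (cmod (ip x (v j)))\<^sup>2)"
proof -
  have "complex_of_real ((vec_norm x)\<^sup>2) = of_real (\<Sum>j\<in>{1..n}. (cmod (ip x (v j)))\<^sup>2)"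
    unfolding ip_self[symmetric] ip_eigenbasis[OF assms(1,2,2)] of_real_sum
    by (simp only: complex_norm_square)
  then show ?thesis using of_real_eq_iff by blast
qed

text \<open>Here \<open>Y\<close> is the inverse of the Riccati solution \<open>X\<close>.
  Multiplying the Riccati equation by \<open>Y\<close> on both sides, with
  \<open>A\<^sup>* = - A\<close>, gives \<open>ric\<close>.\<close>

locale riccati =
  fixes n m :: nat and A B Y :: "complex mat" and l :: "nat \<Rightarrow> real" and v :: "nat \<Rightarrow> complex vec"
  assumes A [simp]: "A \<in> carrier_mat n n" and B [simp]: "B \<in> carrier_mat n m"
    and Y [simp]: "Y \<in> carrier_mat n n"
    and skew: "\<And>x y. \<lbrakk>x \<in> carrier_vec n; y \<in> carrier_vec n\<rbrakk> \<Longrightarrow> ip (A *\<^sub>v x) y = - ip x (A *\<^sub>v y)"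
    and herm: "\<And>x y. \<lbrakk>x \<in> carrier_vec n; y \<in> carrier_vec n\<rbrakk> \<Longrightarrow> ip (Y *\<^sub>v x) y = ip x (Y *\<^sub>v y)"
    and nonneg: "\<And>x. x \<in> carrier_vec n \<Longrightarrow> 0 \<le> Re (ip (Y *\<^sub>v x) x)"
    and inj: "\<And>x. \<lbrakk>x \<in> carrier_vec n; Y *\<^sub>v x = 0\<^sub>v n\<rbrakk> \<Longrightarrow> x = 0\<^sub>v n"
    and ric: "\<And>x. x \<in> carrier_vec n \<Longrightarrow>
      B *\<^sub>v (mat_adjoint B *\<^sub>v x) = Y *\<^sub>v (Y *\<^sub>v x) + A *\<^sub>v (Y *\<^sub>v x) - Y *\<^sub>v (A *\<^sub>v x)"
    and basis: "ordered_eigenbasis n A l v"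
    and n: "2 \<le> n"
begin

lemma vecs [simp]:
  "x \<in> carrier_vec n \<Longrightarrow> A *\<^sub>v x \<in> carrier_vec n"
  "x \<in> carrier_vec n \<Longrightarrow> Y *\<^sub>v x \<in> carrier_vec n"
  "x \<in> carrier_vec n \<Longrightarrow> mat_adjoint B *\<^sub>v x \<in> carrier_vec m"
  "w \<in> carrier_vec m \<Longrightarrow> B *\<^sub>v w \<in> carrier_vec n"
  by (auto intro!: mult_mat_vec_carrier[OF A] mult_mat_vec_carrier[OF B] mult_mat_vec_carrier[OF Y]
      mult_mat_vec_carrier[OF mat_adjoint_carrier[OF B]])

lemma basis_carrier [simp]: "j \<in> {1..n} \<Longrightarrow> v j \<in> carrier_vec n"
  using basis by (simp add: ordered_eigenbasis_def)

lemma eigenvalues_mono: "1 \<le> j \<Longrightarrow> j \<le> k \<Longrightarrow> k \<le> n \<Longrightarrow> l j \<le> l k"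
  using basis by (simp add: ordered_eigenbasis_def)

lemma coef_A:
  assumes "x \<in> carrier_vec n" "j \<in> {1..n}"
  shows "ip (A *\<^sub>v x) (v j) = \<i> * of_real (l j) * ip x (v j)"
proof -
  have "A *\<^sub>v v j = (\<i> * of_real (l j)) \<cdot>\<^sub>v v j"
    using basis assms by (simp add: ordered_eigenbasis_def)
  then show ?thesis using skew[of x "v j"] assms by (simp add: ip_smult_right[of _ n])
qed

lemma ip_B: "w \<in> carrier_vec m \<Longrightarrow> y \<in> carrier_vec n \<Longrightarrow> ip (B *\<^sub>v w) y = ip w (mat_adjoint B *\<^sub>v y)"
  by (rule ip_adjoint[OF B])

lemma Re_skew: "x \<in> carrier_vec n \<Longrightarrow> Re (ip (A *\<^sub>v x) x) = 0"
  using skew[of x x] Re_ip_commute[of x n "A *\<^sub>v x"] by simp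

text \<open>This is \<open>ric\<close> as a quadratic form: after moving \<open>A\<close> and
  \<open>Y\<close> across, the two mixed terms are complex conjugates. It holds for every vector, as
  the counting argument needs.\<close>

lemma norm_adjoint_B:
  assumes "y \<in> carrier_vec n"
  shows "(vec_norm (mat_adjoint B *\<^sub>v y))\<^sup>2
    = (vec_norm (Y *\<^sub>v y))\<^sup>2 - 2 * Re (ip (Y *\<^sub>v y) (A *\<^sub>v y))"
proof -
  let ?w = "mat_adjoint B *\<^sub>v y"
  have "(vec_norm ?w)\<^sup>2 = Re (ip (B *\<^sub>v ?w) y)"
    using assms by (simp add: ip_B ip_self)
  also have "\<dots> = Re (ip (Y *\<^sub>v y) (Y *\<^sub>v y) - ip (Y *\<^sub>v y) (A *\<^sub>v y) - ip (A *\<^sub>v y) (Y *\<^sub>v y))"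
    using assms by (simp add: ric ip_diff_left[of _ n] ip_add_left[of _ n] herm skew)
  also have "\<dots> = (vec_norm (Y *\<^sub>v y))\<^sup>2 - 2 * Re (ip (Y *\<^sub>v y) (A *\<^sub>v y))"
    using assms Re_ip_commute[of "A *\<^sub>v y" n "Y *\<^sub>v y"] by (simp add: ip_self)
  finally show ?thesis .
qed

end

section \<open>Moment identities for an eigenvector of \<open>A - Y\<close>\<close>

locale riccati_eigen = riccati +
  fixes y :: "complex vec" and \<mu> :: complex
  assumes y [simp]: "y \<in> carrier_vec n" and y0: "y \<noteq> 0\<^sub>v n"
    and eig: "A *\<^sub>v y - Y *\<^sub>v y = \<mu> \<cdot>\<^sub>v y"
begin

text \<open>The eigenvalue is written \<open>\<mu> = - a + \<i> b\<close>. The weights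
  \<open>p j\<close> are not normalised; they sum to
  \<open>\<parallel>y\<parallel>\<^sup>2\<close>.\<close>

abbreviation "p j \<equiv> (cmod (ip y (v j)))\<^sup>2"
abbreviation "a \<equiv> - Re \<mu>"
abbreviation "b \<equiv> Im \<mu>"
abbreviation "u \<equiv> vec_norm (mat_adjoint B *\<^sub>v y)"

lemma norm_pos: "0 < vec_norm y"
  using vec_norm_pos_iff[OF y] y0 by simp

text \<open>Pairing the eigenvalue equation with \<open>Y y\<close> and inserting
  \<open>norm_adjoint_B\<close> gives \<open>Re \<mu> \<langle>y, Y y\<rangle> = - (\<parallel>Y
  y\<parallel>\<^sup>2 + u\<^sup>2) / 2 < 0\<close>, while \<open>\<langle>y, Y y\<rangle>\<close>
  is real and nonnegative.\<close>

lemma a_pos: "0 < a"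
proof -
  have "Re (ip (A *\<^sub>v y - Y *\<^sub>v y) (Y *\<^sub>v y)) = Re (ip (A *\<^sub>v y) (Y *\<^sub>v y)) - (vec_norm (Y *\<^sub>v y))\<^sup>2"
    by (simp add: ip_diff_left[of _ n] ip_self)
  also have "Re (ip (A *\<^sub>v y) (Y *\<^sub>v y)) = ((vec_norm (Y *\<^sub>v y))\<^sup>2 - u\<^sup>2) / 2"
    using norm_adjoint_B[OF y] Re_ip_commute[of "A *\<^sub>v y" n "Y *\<^sub>v y"] by simp
  finally have "Re (\<mu> * ip y (Y *\<^sub>v y)) = - ((vec_norm (Y *\<^sub>v y))\<^sup>2 + u\<^sup>2) / 2"
    by (simp add: eig ip_smult_left field_simps)
  moreover have "Im (ip y (Y *\<^sub>v y)) = 0"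
    using cnj_ip[of y n "Y *\<^sub>v y"] herm[of y y] by (simp add: complex_eq_iff)
  ultimately have "Re \<mu> * Re (ip y (Y *\<^sub>v y)) = - ((vec_norm (Y *\<^sub>v y))\<^sup>2 + u\<^sup>2) / 2"
    by simp
  also have "\<dots> < 0"
  proof -
    have "0 < (vec_norm (Y *\<^sub>v y))\<^sup>2 + u\<^sup>2"
      using vec_norm_pos_iff[of "Y *\<^sub>v y" n] inj[of y] y0 by (intro add_pos_nonneg) auto
    then show ?thesis by (simp only: divide_less_0_iff neg_less_0_iff_less) simp
  qed
  finally have "Re \<mu> * Re (ip y (Y *\<^sub>v y)) < 0" .
  moreover have "0 \<le> Re (ip y (Y *\<^sub>v y))"
    using nonneg[OF y] herm[of y y] by simp
  ultimately show ?thesis by (simp add: mult_less_0_iff)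
qed

lemma coef_Y:
  assumes "j \<in> {1..n}"
  shows "ip (Y *\<^sub>v y) (v j) = (\<i> * of_real (l j) - \<mu>) * ip y (v j)"
proof -
  have "ip (A *\<^sub>v y - Y *\<^sub>v y) (v j) = \<mu> * ip y (v j)"
    by (simp add: eig ip_smult_left)
  then show ?thesis
    using assms by (simp add: ip_diff_left[of _ n] coef_A algebra_simps)
qed

text \<open>From \<open>Y A y = Y Y y + \<mu> Y y\<close>, \<open>ric\<close> becomes
  \<open>B B\<^sup>* y = (A - \<mu>) Y y\<close>, and \<open>Y y = (A - \<mu>) y\<close>; this is
  the result in coordinates.\<close>

lemma coef_BB:
  assumes "j \<in> {1..n}"
  shows "ip (B *\<^sub>v (mat_adjoint B *\<^sub>v y)) (v j) = (\<i> * of_real (l j) - \<mu>)\<^sup>2 * ip y (v j)"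
proof -
  have "A *\<^sub>v y = Y *\<^sub>v y + \<mu> \<cdot>\<^sub>v y"
    unfolding eig[symmetric] by (rule eq_vecI) (use carrier_vecD[OF vecs(1)[OF y]] carrier_vecD[OF vecs(2)[OF y]] in auto)
  then have "Y *\<^sub>v (A *\<^sub>v y) = Y *\<^sub>v (Y *\<^sub>v y) + \<mu> \<cdot>\<^sub>v (Y *\<^sub>v y)"
    by (simp add: mult_add_distrib_mat_vec[of _ n n] mult_mat_vec[of _ n n])
  then have "ip (B *\<^sub>v (mat_adjoint B *\<^sub>v y)) (v j) = ip (A *\<^sub>v (Y *\<^sub>v y)) (v j) - \<mu> * ip (Y *\<^sub>v y) (v j)"
    by (simp add: ric ip_diff_left[of _ n] ip_add_left[of _ n] ip_smult_left)
  then show ?thesis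
    using assms by (simp add: coef_A coef_Y power2_eq_square algebra_simps)
qed

lemma mom0: "(\<Sum>j\<in>{1..n}. p j) = (vec_norm y)\<^sup>2"
  using vec_norm_eigenbasis[OF basis y] by simp

lemma char_square: "(\<i> * of_real (l j) - \<mu>)\<^sup>2 = Complex (a\<^sup>2 - (l j - b)\<^sup>2) (2 * a * (l j - b))"
  by (simp add: complex_eq_iff power2_eq_square)

text \<open>The left side is real: the imaginary part gives \<open>mom1\<close>, the real part
  \<open>mom2\<close>.\<close>

lemma quadratic_form: "of_real (u\<^sup>2) = (\<Sum>j\<in>{1..n}. (\<i> * of_real (l j) - \<mu>)\<^sup>2 * of_real (p j))"
proof -
  have "of_real (u\<^sup>2) = ip (B *\<^sub>v (mat_adjoint B *\<^sub>v y)) y"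
    by (simp add: ip_B ip_self)
  also have "\<dots> = (\<Sum>j\<in>{1..n}. (\<i> * of_real (l j) - \<mu>)\<^sup>2 * of_real (p j))"
    by (subst ip_eigenbasis[OF basis])
      (auto simp: coef_BB mult.assoc simp flip: complex_norm_square intro!: sum.cong)
  finally show ?thesis .
qed

text \<open>As \<open>a \<noteq> 0\<close>, the vanishing imaginary part makes \<open>b\<close> the
  \<open>p\<close>-weighted mean of the \<open>l j\<close>.\<close>

lemma mom1: "(\<Sum>j\<in>{1..n}. (l j - b) * p j) = 0"
proof -
  have "0 = Im (\<Sum>j\<in>{1..n}. (\<i> * of_real (l j) - \<mu>)\<^sup>2 * of_real (p j))"
    unfolding quadratic_form[symmetric] by simp
  also have "\<dots> = 2 * a * (\<Sum>j\<in>{1..n}. (l j - b) * p j)"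
    unfolding Im_sum sum_distrib_left char_square by (intro sum.cong) auto
  finally show ?thesis using a_pos by simp
qed

lemma mom2: "u\<^sup>2 = (\<Sum>j\<in>{1..n}. (a\<^sup>2 - (l j - b)\<^sup>2) * p j)"
proof -
  have "u\<^sup>2 = Re (\<Sum>j\<in>{1..n}. (\<i> * of_real (l j) - \<mu>)\<^sup>2 * of_real (p j))"
    unfolding quadratic_form[symmetric] by simp
  also have "\<dots> = (\<Sum>j\<in>{1..n}. (a\<^sup>2 - (l j - b)\<^sup>2) * p j)"
    unfolding Re_sum char_square by (intro sum.cong) auto
  finally show ?thesis .
qed

lemma mom4: "(vec_norm (B *\<^sub>v (mat_adjoint B *\<^sub>v y)))\<^sup>2 = (\<Sum>j\<in>{1..n}. (a\<^sup>2 + (l j - b)\<^sup>2)\<^sup>2 * p j)"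
proof -
  have "cmod ((\<i> * of_real (l j) - \<mu>)\<^sup>2) = a\<^sup>2 + (l j - b)\<^sup>2" for j
    by (simp add: norm_power cmod_power2)
  then show ?thesis
    by (subst vec_norm_eigenbasis[OF basis])
      (auto simp: coef_BB norm_mult power_mult_distrib intro!: sum.cong)
qed

text \<open>Dropping \<open>(l j - b)\<^sup>2\<close> in \<open>mom4\<close> leaves a bound that
  yields both \<open>u > 0\<close> and \<open>a \<le> \<parallel>B\<parallel>\<close>.\<close>

lemma mom4_ge: "a ^ 4 * (vec_norm y)\<^sup>2 \<le> (vec_norm (B *\<^sub>v (mat_adjoint B *\<^sub>v y)))\<^sup>2"
proof -
  have "a ^ 4 * (vec_norm y)\<^sup>2 = (\<Sum>j\<in>{1..n}. (a\<^sup>2)\<^sup>2 * p j)"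
    by (simp add: sum_distrib_left flip: mom0)
  also have "\<dots> \<le> (\<Sum>j\<in>{1..n}. (a\<^sup>2 + (l j - b)\<^sup>2)\<^sup>2 * p j)"
    by (intro sum_mono mult_right_mono power_mono) auto
  finally show ?thesis by (simp add: mom4)
qed

lemma u_pos: "0 < u"
proof (rule ccontr)
  assume "\<not> 0 < u"
  then have "mat_adjoint B *\<^sub>v y = 0\<^sub>v m" using vec_norm_pos_iff[of "mat_adjoint B *\<^sub>v y" m] by simp
  then have "B *\<^sub>v (mat_adjoint B *\<^sub>v y) = 0\<^sub>v n"
    by (intro eq_vecI) (use carrier_matD[OF B] in auto)
  then have "a ^ 4 * (vec_norm y)\<^sup>2 \<le> 0" using mom4_ge by (simp add: vec_norm_def)
  moreover have "0 < a ^ 4 * (vec_norm y)\<^sup>2" using a_pos norm_pos by (intro mult_pos_pos) auto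
  ultimately show False by simp
qed

section \<open>Box, triangles, disks and the gap in the real parts\<close>

lemma Im_bounds: "l 1 \<le> b" "b \<le> l n"
proof -
  have "l 1 * (vec_norm y)\<^sup>2 \<le> (\<Sum>j\<in>{1..n}. l j * p j)"
    unfolding mom0[symmetric] sum_distrib_left
    by (intro sum_mono mult_right_mono) (auto intro: eigenvalues_mono)
  moreover have "(\<Sum>j\<in>{1..n}. l j * p j) \<le> l n * (vec_norm y)\<^sup>2"
    unfolding mom0[symmetric] sum_distrib_left
    by (intro sum_mono mult_right_mono) (auto intro: eigenvalues_mono)
  moreover have "(\<Sum>j\<in>{1..n}. l j * p j) = b * (vec_norm y)\<^sup>2"
    using mom1 by (simp add: left_diff_distrib sum_subtractf flip: mom0 sum_distrib_left)
  ultimately show "l 1 \<le> b" "b \<le> l n" using norm_pos by auto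
qed

lemma a_le_op_norm: "a \<le> op_norm B"
proof -
  let ?N = "op_norm B"
  have N: "0 \<le> ?N" by (rule op_norm_nonneg[OF B])
  have "vec_norm (B *\<^sub>v (mat_adjoint B *\<^sub>v y)) \<le> ?N * u"
    by (rule vec_norm_mult_op_norm[OF B]) simp
  also have "\<dots> \<le> ?N * (?N * vec_norm y)"
    by (intro mult_left_mono N vec_norm_adjoint_op_norm[OF B]) simp
  finally have "(vec_norm (B *\<^sub>v (mat_adjoint B *\<^sub>v y)))\<^sup>2 \<le> (?N * (?N * vec_norm y))\<^sup>2"
    by (intro power_mono) auto
  with mom4_ge have "a ^ 4 * (vec_norm y)\<^sup>2 \<le> ?N ^ 4 * (vec_norm y)\<^sup>2"
    by (simp add: power_mult_distrib flip: power_mult power_add)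
  then have "a ^ 4 \<le> ?N ^ 4" using norm_pos by (simp add: mult_le_cancel_right)
  \<comment> \<open>The rule compares powers with exponent \<open>Suc 3\<close>.\<close>
  then show ?thesis using N power_le_imp_le_base[of a 3 ?N] by (simp add: numeral_eq_Suc)
qed

text \<open>In the triangle the interval from \<open>b - a\<close> to \<open>b + a\<close> fits
  between the consecutive values \<open>l k\<close> and \<open>l (k + 1)\<close>. Then every term of
  \<open>mom2\<close> is nonpositive, contradicting \<open>u > 0\<close>.\<close>

lemma not_in_right_triangle:
  assumes k: "k \<in> {1..n - 1}"
  shows "\<mu> \<notin> right_triangle l k"
proof
  assume "\<mu> \<in> right_triangle l k"
  have lk: "l k \<le> l (k + 1)" using k by (intro eigenvalues_mono) auto
  \<comment> \<open>The wedge bounded by the lines through the two legs, which have slopes 1 and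
    -1.\<close>
  define S where "S = {z. l k \<le> Im z + Re z \<and> Im z - Re z \<le> l (k + 1)}"
  have "convex S"
  proof (rule convexI)
    fix x z and s t :: real
    assume "x \<in> S" "z \<in> S" "0 \<le> s" "0 \<le> t" "s + t = 1"
    then have "s * l k + t * l k \<le> s * (Im x + Re x) + t * (Im z + Re z)"
      "s * (Im x - Re x) + t * (Im z - Re z) \<le> s * l (k + 1) + t * l (k + 1)"
      unfolding S_def by (auto intro!: add_mono mult_left_mono)
    moreover have "s * c + t * c = c" for c
      using \<open>s + t = 1\<close> by (simp flip: distrib_right)
    ultimately show "s *\<^sub>R x + t *\<^sub>R z \<in> S"
      by (simp add: S_def algebra_simps)
  qed
  moreover have "{Complex 0 (l k), Complex 0 (l (k + 1)),
      Complex (- (l (k + 1) - l k) / 2) ((l (k + 1) + l k) / 2)} \<subseteq> S"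
    using lk by (auto simp: S_def field_simps)
  ultimately have "right_triangle l k \<subseteq> S"
    unfolding right_triangle_def by (intro hull_minimal) auto
  then have ab: "l k \<le> b - a" "b + a \<le> l (k + 1)"
    using \<open>\<mu> \<in> right_triangle l k\<close> by (auto simp: S_def)
  have "a\<^sup>2 \<le> (l j - b)\<^sup>2" if j: "j \<in> {1..n}" for j
  proof (cases "j \<le> k")
    case True
    then have "l j \<le> l k" using j k by (intro eigenvalues_mono) auto
    then have "a \<le> b - l j" using ab by simp
    then have "a\<^sup>2 \<le> (b - l j)\<^sup>2" using a_pos by (intro power_mono) auto
    then show ?thesis by (simp add: power2_commute)
  next
    case False
    then have "l (k + 1) \<le> l j" using j k by (intro eigenvalues_mono) auto
    then have "a \<le> l j - b" using ab by simp
    then show ?thesis using a_pos by (intro power_mono) auto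
  qed
  then have "u\<^sup>2 \<le> 0"
    unfolding mom2 by (intro sum_nonpos mult_nonpos_nonneg) auto
  then show False using u_pos by simp
qed

text \<open>
  This uses \<open>\<delta>\<^sup>2 \<parallel>y - c v\<^sub>k\<parallel>\<^sup>2 + \<parallel>B\<^sup>* y\<parallel>\<^sup>2 \<le> |\<mu> - \<i> \<lambda>\<^sub>k|\<^sup>2 \<parallel>y\<parallel>\<^sup>2\<close> with \<open>c = \<langle>y, v\<^sub>k\<rangle>\<close>, together
  with the triangle inequality for \<open>c B\<^sup>* v\<^sub>k\<close>. It gives the larger radii for every \<open>m\<close>.
\<close>

lemma disk_estimate:
  assumes k: "k \<in> {1..n}" and gap: "0 < spectral_gap n l k"
  shows "(vec_norm (mat_adjoint B *\<^sub>v v k))\<^sup>2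
    < (1 + 2 * ((op_norm B)\<^sup>2 / (spectral_gap n l k)\<^sup>2)) * (cmod (\<mu> - \<i> * of_real (l k)))\<^sup>2"
proof -
  let ?\<delta> = "spectral_gap n l k" and ?N = "op_norm B"
  define r where "r = cmod (\<mu> - \<i> * of_real (l k))"
  define \<beta> where "\<beta> = vec_norm (mat_adjoint B *\<^sub>v v k)"
  define c where "c = ip y (v k)"
  define s where "s = vec_norm (y - c \<cdot>\<^sub>v v k)"
  define nn where "nn = (vec_norm y)\<^sup>2"
  have nn: "0 < nn" using norm_pos by (simp add: nn_def)
  have r2: "r\<^sup>2 = a\<^sup>2 + (l k - b)\<^sup>2"
    by (simp add: r_def cmod_power2 power2_commute)
  \<comment> \<open>\<open>mom2\<close> is recentred from \<open>b\<close> to \<open>l k\<close>;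
    the cross term vanishes by \<open>mom1\<close>.\<close>
  have "u\<^sup>2 = (\<Sum>j\<in>{1..n}. (a\<^sup>2 + (l k - b)\<^sup>2) * p j - (l j - l k)\<^sup>2 * p j - 2 * (l k - b) * ((l j - b) * p j))"
    unfolding mom2 by (intro sum.cong) (auto simp: power2_eq_square algebra_simps)
  also have "\<dots> = r\<^sup>2 * nn - (\<Sum>j\<in>{1..n}. (l j - l k)\<^sup>2 * p j)"
    by (simp add: sum_subtractf mom1 mom0 nn_def r2 del: One_nat_def flip: sum_distrib_left)
  finally have spread: "(\<Sum>j\<in>{1..n}. (l j - l k)\<^sup>2 * p j) = r\<^sup>2 * nn - u\<^sup>2" by simp
  have vk: "ip (v k) (v j) = (if j = k then 1 else 0)" if "j \<in> {1..n}" for j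
    using basis k that by (auto simp: ordered_eigenbasis_def ip_cscalar[of _ n])
  have s2: "s\<^sup>2 = (\<Sum>j\<in>{1..n} - {k}. p j)"
  proof -
    have "s\<^sup>2 = (\<Sum>j\<in>{1..n}. (cmod (ip (y - c \<cdot>\<^sub>v v k) (v j)))\<^sup>2)"
      unfolding s_def using k by (intro vec_norm_eigenbasis[OF basis]) auto
    also have "\<dots> = (\<Sum>j\<in>{1..n} - {k}. p j)"
      using k by (intro sum.mono_neutral_cong_right)
        (auto simp: ip_diff_left[of _ n] ip_smult_left vk c_def)
    finally show ?thesis .
  qed
  have c2: "(cmod c)\<^sup>2 = nn - s\<^sup>2"
    using mom0 sum.remove[of "{1..n}" k p] k by (simp add: s2 nn_def c_def)
  have "?\<delta>\<^sup>2 * s\<^sup>2 \<le> (\<Sum>j\<in>{1..n}. (l j - l k)\<^sup>2 * p j)"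
  proof -
    have "?\<delta>\<^sup>2 * p j \<le> (l j - l k)\<^sup>2 * p j" if "j \<in> {1..n} - {k}" for j
    proof -
      have "?\<delta> \<le> \<bar>l j - l k\<bar>"
        unfolding spectral_gap_def using that by (intro Min_le) auto
      then have "?\<delta>\<^sup>2 \<le> \<bar>l j - l k\<bar>\<^sup>2" using gap by (intro power_mono) auto
      then show ?thesis by (intro mult_right_mono) auto
    qed
    then have "?\<delta>\<^sup>2 * s\<^sup>2 \<le> (\<Sum>j\<in>{1..n} - {k}. (l j - l k)\<^sup>2 * p j)"
      unfolding s2 sum_distrib_left by (intro sum_mono) auto
    also have "\<dots> \<le> (\<Sum>j\<in>{1..n}. (l j - l k)\<^sup>2 * p j)"
      by (intro sum_mono2) auto
    finally show ?thesis .
  qed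
  then have main: "?\<delta>\<^sup>2 * s\<^sup>2 + u\<^sup>2 \<le> r\<^sup>2 * nn" using spread by simp
  have "cmod c * \<beta> \<le> u + ?N * s"
  proof -
    have "mat_adjoint B *\<^sub>v y - mat_adjoint B *\<^sub>v (y - c \<cdot>\<^sub>v v k) = c \<cdot>\<^sub>v (mat_adjoint B *\<^sub>v v k)"
      using k by (subst mult_minus_distrib_mat_vec[OF mat_adjoint_carrier[OF B]])
        (auto simp: mult_mat_vec[OF mat_adjoint_carrier[OF B]])
    then have "cmod c * \<beta> = vec_norm (mat_adjoint B *\<^sub>v y - mat_adjoint B *\<^sub>v (y - c \<cdot>\<^sub>v v k))"
      by (simp add: vec_norm_smult \<beta>_def)
    also have "\<dots> \<le> u + vec_norm (mat_adjoint B *\<^sub>v (y - c \<cdot>\<^sub>v v k))"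
      using k by (intro vec_norm_triangle_sub[of _ m]) auto
    also have "vec_norm (mat_adjoint B *\<^sub>v (y - c \<cdot>\<^sub>v v k)) \<le> ?N * s"
      unfolding s_def using k by (intro vec_norm_adjoint_op_norm[OF B]) auto
    finally show ?thesis by simp
  qed
  then have "(cmod c * \<beta>)\<^sup>2 \<le> (u + ?N * s)\<^sup>2"
    by (intro power_mono) (auto simp: \<beta>_def)
  then have h1: "\<beta>\<^sup>2 * (nn - s\<^sup>2) \<le> (u + ?N * s)\<^sup>2"
    by (simp add: power_mult_distrib c2 mult.commute)
  have N: "0 < ?N"
    using vec_norm_adjoint_op_norm[OF B y] u_pos norm_pos op_norm_nonneg[OF B]
    by (cases "?N = 0") auto
  define q where "q = ?N\<^sup>2 / ?\<delta>\<^sup>2"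
  have N2: "?N\<^sup>2 = q * ?\<delta>\<^sup>2" and q: "0 < q" using gap N by (auto simp: q_def)
  \<comment> \<open>Cauchy-Schwarz for \<open>(1, N / \<delta>)\<close> and
    \<open>(u, \<delta> s)\<close>, with explicit remainder.\<close>
  have h2: "(u + ?N * s)\<^sup>2 \<le> (1 + q) * (u\<^sup>2 + ?\<delta>\<^sup>2 * s\<^sup>2)"
  proof -
    have "0 \<le> (?\<delta>\<^sup>2 * s - ?N * u)\<^sup>2 / ?\<delta>\<^sup>2" by simp
    also have "\<dots> = (1 + q) * (u\<^sup>2 + ?\<delta>\<^sup>2 * s\<^sup>2) - (u + ?N * s)\<^sup>2"
      using gap by (simp add: q_def field_simps power2_eq_square)
    finally show ?thesis by simp
  qed
  have "\<beta> \<le> ?N"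
  proof -
    have "complex_of_real ((vec_norm (v k))\<^sup>2) = of_real 1"
      using vk[OF k] by (simp only: ip_self[symmetric]) simp
    then have "(vec_norm (v k))\<^sup>2 = 1" by (simp only: of_real_eq_iff)
    then have "vec_norm (v k) = 1" using vec_norm_nonneg[of "v k"] by (simp add: power2_eq_1_iff)
    then show ?thesis using vec_norm_adjoint_op_norm[OF B, of "v k"] k by (simp add: \<beta>_def)
  qed
  then have "\<beta>\<^sup>2 \<le> ?N\<^sup>2" by (intro power_mono) (auto simp: \<beta>_def)
  \<comment> \<open>This restores the part \<open>\<beta>\<^sup>2 s\<^sup>2\<close> missing in
    \<open>h1\<close>. It costs another \<open>q\<close>, hence the factor \<open>1 + 2 q\<close>;
    strictness comes from \<open>u > 0\<close> and excludes the boundary of the disk.\<close>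
  then have "\<beta>\<^sup>2 * s\<^sup>2 \<le> q * (?\<delta>\<^sup>2 * s\<^sup>2)"
    using mult_right_mono[of "\<beta>\<^sup>2" "?N\<^sup>2" "s\<^sup>2"] by (simp add: N2 mult.assoc)
  also have "\<dots> < q * (r\<^sup>2 * nn)"
  proof (rule mult_strict_left_mono[OF _ q])
    have "0 < u\<^sup>2" using u_pos by simp
    then show "?\<delta>\<^sup>2 * s\<^sup>2 < r\<^sup>2 * nn" using main by linarith
  qed
  finally have "\<beta>\<^sup>2 * nn < (u + ?N * s)\<^sup>2 + q * (r\<^sup>2 * nn)"
    using h1 by (simp add: right_diff_distrib)
  also have "(u + ?N * s)\<^sup>2 \<le> (1 + q) * (r\<^sup>2 * nn)"
    using h2 main q by (smt (verit) mult_left_mono)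
  finally have "\<beta>\<^sup>2 * nn < ((1 + 2 * q) * r\<^sup>2) * nn" by (simp add: algebra_simps)
  then have "\<beta>\<^sup>2 < (1 + 2 * q) * r\<^sup>2" using nn by (simp add: mult_less_cancel_right)
  then show ?thesis by (simp add: \<beta>_def q_def r_def)
qed

lemma not_in_disk1:
  assumes k: "k \<in> {1..n}"
  shows "rho1 n B l v k < cmod (\<mu> - \<i> * of_real (l k))"
proof (cases "spectral_gap n l k = 0")
  case True
  \<comment> \<open>With zero gap the radius is 0 by convention, and the closed disk is its centre
    on the imaginary axis.\<close>
  have "Re (\<mu> - \<i> * of_real (l k)) \<noteq> 0" using a_pos by simp
  then have "\<mu> - \<i> * of_real (l k) \<noteq> 0" by (metis zero_complex.simps(1))
  then show ?thesis using True by (simp add: rho1_def)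
next
  case False
  \<comment> \<open>Because \<open>2 \<le> n\<close>, the minimum in \<open>spectral_gap\<close> is
    over a nonempty set and is attained.\<close>
  have "card ({1..n} - {k}) \<noteq> 0" using n k by simp
  then have "(\<lambda>j. \<bar>l j - l k\<bar>) ` ({1..n} - {k}) \<noteq> {}" by (metis card.empty image_is_empty)
  then have "spectral_gap n l k \<in> (\<lambda>j. \<bar>l j - l k\<bar>) ` ({1..n} - {k})"
    unfolding spectral_gap_def by (intro Min_in) auto
  then have gap: "0 < spectral_gap n l k" using False by auto
  let ?Q = "1 + 2 * ((op_norm B)\<^sup>2 / (spectral_gap n l k)\<^sup>2)"
  have Q: "0 < ?Q" by (simp add: add_pos_nonneg)
  from disk_estimate[OF k gap] have
    "vec_norm (mat_adjoint B *\<^sub>v v k) < sqrt (?Q * (cmod (\<mu> - \<i> * of_real (l k)))\<^sup>2)"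
    by (rule real_less_rsqrt)
  also have "\<dots> = cmod (\<mu> - \<i> * of_real (l k)) * sqrt ?Q"
    by (simp add: real_sqrt_mult)
  finally show ?thesis
    using False Q by (simp add: rho1_def divide_less_eq)
qed

text \<open>With \<open>x = a\<^sup>2\<close>, failure would give
  \<open>\<sigma>\<^sup>2 \<ge> 8 / 3 x\<close>. The variance bound and \<open>large\<close> make
  \<open>u\<^sup>2\<close> nearly \<open>x \<parallel>y\<parallel>\<^sup>2\<close> and
  \<open>\<parallel>B B\<^sup>* y\<parallel>\<^sup>2\<close> nearly
  \<open>x\<^sup>2 \<parallel>y\<parallel>\<^sup>2\<close>, which contradicts
  \<open>\<sigma> u \<le> \<parallel>B B\<^sup>* y\<parallel>\<close>.\<close>

lemma spectral_dichotomy: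
  assumes \<sigma>: "0 \<le> \<sigma>" "\<And>w. w \<in> carrier_vec m \<Longrightarrow> \<sigma> * vec_norm w \<le> vec_norm (B *\<^sub>v w)"
    and large: "9 / 4 * (l n - l 1)\<^sup>2 \<le> a\<^sup>2"
  shows "3 * \<sigma>\<^sup>2 < 8 * a\<^sup>2"
proof (rule ccontr)
  assume "\<not> 3 * \<sigma>\<^sup>2 < 8 * a\<^sup>2"
  then have small: "8 / 3 * a\<^sup>2 \<le> \<sigma>\<^sup>2" by simp
  define D where "D = (l n - l 1)\<^sup>2"
  define x where "x = a\<^sup>2"
  define nn where "nn = (vec_norm y)\<^sup>2"
  define S where "S = (\<Sum>j\<in>{1..n}. (l j - b)\<^sup>2 * p j)"
  have nn: "0 < nn" using norm_pos by (simp add: nn_def)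
  have x: "0 < x" using a_pos by (simp add: x_def)
  have lj: "l 1 \<le> l j" "l j \<le> l n" if "j \<in> {1..n}" for j
    using that by (auto intro: eigenvalues_mono)
  (* Popoviciu's bound on the variance of a distribution on [l 1, l n] *)
  have S: "S \<le> D / 4 * nn"
  proof -
    have "0 \<le> (\<Sum>j\<in>{1..n}. (l j - l 1) * (l n - l j) * p j)"
      using lj by (intro sum_nonneg mult_nonneg_nonneg) auto
    also have "\<dots> = (\<Sum>j\<in>{1..n}. (b - l 1) * (l n - b) * p j + (l n + l 1 - 2 * b) * ((l j - b) * p j) - (l j - b)\<^sup>2 * p j)"
      by (intro sum.cong) (auto simp: power2_eq_square algebra_simps)
    also have "\<dots> = (b - l 1) * (l n - b) * nn - S"
      by (simp add: sum_subtractf sum.distrib mom0 mom1 nn_def S_def del: One_nat_def flip: sum_distrib_left)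
    finally have "S \<le> (b - l 1) * (l n - b) * nn" by simp
    also have "(b - l 1) * (l n - b) \<le> D / 4"
    proof -
      have "0 \<le> (l n + l 1 - 2 * b)\<^sup>2" by simp
      then show ?thesis by (simp add: D_def power2_eq_square algebra_simps)
    qed
    finally show ?thesis using nn by (simp add: mult_right_mono)
  qed
  have u2: "u\<^sup>2 = x * nn - S"
    by (simp add: mom2 left_diff_distrib sum_subtractf S_def x_def nn_def mom0 del: One_nat_def flip: sum_distrib_left)
  have "\<sigma>\<^sup>2 * u\<^sup>2 \<le> (vec_norm (B *\<^sub>v (mat_adjoint B *\<^sub>v y)))\<^sup>2"
    unfolding power_mult_distrib[symmetric] using \<sigma> by (intro power_mono) auto
  \<comment> \<open>Both \<open>l j\<close> and \<open>b\<close> lie in \<open>[l 1, l n]\<close>,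
    so the fourth power of \<open>l j - b\<close> is at most \<open>D\<close> times its square, and
    only the variance \<open>S\<close> remains.\<close>
  also have "\<dots> \<le> (\<Sum>j\<in>{1..n}. x\<^sup>2 * p j + (2 * x + D) * ((l j - b)\<^sup>2 * p j))"
    unfolding mom4
  proof (intro sum_mono)
    fix j assume j: "j \<in> {1..n}"
    have "\<bar>l j - b\<bar> \<le> \<bar>l n - l 1\<bar>" using lj[OF j] Im_bounds by simp
    then have "(l j - b)\<^sup>2 \<le> D" unfolding D_def by (simp only: abs_le_square_iff)
    then have "(l j - b)\<^sup>2 * (l j - b)\<^sup>2 \<le> D * (l j - b)\<^sup>2" by (intro mult_right_mono) auto
    then have "(a\<^sup>2 + (l j - b)\<^sup>2)\<^sup>2 \<le> x\<^sup>2 + (2 * x + D) * (l j - b)\<^sup>2"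
      by (simp add: x_def power2_sum algebra_simps power2_eq_square[of "(l j - b)\<^sup>2"])
    then have "(a\<^sup>2 + (l j - b)\<^sup>2)\<^sup>2 * p j \<le> (x\<^sup>2 + (2 * x + D) * (l j - b)\<^sup>2) * p j"
      by (intro mult_right_mono) auto
    then show "(a\<^sup>2 + (l j - b)\<^sup>2)\<^sup>2 * p j \<le> x\<^sup>2 * p j + (2 * x + D) * ((l j - b)\<^sup>2 * p j)"
      by (simp add: algebra_simps)
  qed
  also have "\<dots> = x\<^sup>2 * nn + (2 * x + D) * S"
    by (simp add: sum.distrib mom0 nn_def S_def del: One_nat_def flip: sum_distrib_left)
  also have "\<dots> \<le> x\<^sup>2 * nn + (2 * x + D) * (D / 4 * nn)"
    using S x by (intro add_left_mono mult_left_mono) (auto simp: D_def)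
  finally have up: "\<sigma>\<^sup>2 * u\<^sup>2 \<le> (x\<^sup>2 + (2 * x + D) * (D / 4)) * nn"
    by (simp add: algebra_simps add_divide_distrib)
  have Dx: "D \<le> 4 / 9 * x" and D0: "0 \<le> D" using large by (auto simp: D_def x_def)
  have "8 / 9 * x * nn \<le> u\<^sup>2"
  proof -
    have "D * nn \<le> 4 / 9 * x * nn" using Dx nn by (intro mult_right_mono) auto
    moreover have "S \<le> D * nn / 4" using S by simp
    ultimately have "S \<le> 1 / 9 * x * nn" by linarith
    then show ?thesis by (simp add: u2 mult.commute)
  qed
  then have "8 / 3 * x * (8 / 9 * x * nn) \<le> \<sigma>\<^sup>2 * u\<^sup>2"
    using small x nn by (intro mult_mono) (auto simp: x_def)
  moreover have "(x\<^sup>2 + (2 * x + D) * (D / 4)) * nn \<le> (x\<^sup>2 + (2 * x + 4 / 9 * x) * (1 / 9 * x)) * nn"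
    using Dx D0 x nn by (intro mult_right_mono add_left_mono mult_mono) auto
  ultimately have "8 / 3 * x * (8 / 9 * x * nn) \<le> (x\<^sup>2 + (2 * x + 4 / 9 * x) * (1 / 9 * x)) * nn"
    using up by linarith
  \<comment> \<open>Here \<open>64 / 27 = 8 / 3 * 8 / 9\<close> and
    \<open>103 / 81 = 1 + 22 / 9 * 1 / 9\<close>.\<close>
  then have "64 / 27 * (x\<^sup>2 * nn) \<le> 103 / 81 * (x\<^sup>2 * nn)"
    by (simp add: power2_eq_square algebra_simps)
  moreover have "0 < x\<^sup>2 * nn" using x nn by simp
  ultimately show False by linarith
qed

end

section \<open>Separation of the spectrum\<close>

lemma invertible_matI:
  fixes H :: "complex mat"
  assumes H: "H \<in> carrier_mat n n" and inj: "\<And>x. \<lbrakk>x \<in> carrier_vec n; H *\<^sub>v x = 0\<^sub>v n\<rbrakk> \<Longrightarrow> x = 0\<^sub>v n"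
  obtains R where "R \<in> carrier_mat n n" "H * R = 1\<^sub>m n" "R * H = 1\<^sub>m n"
proof -
  have "det H \<noteq> 0" using det_0_iff_vec_prod_zero[OF H] inj by blast
  from det_non_zero_imp_unit[OF H this] show thesis
    using that unfolding Units_def ring_mat_def by auto
qed

lemma mat_eq_vecI:
  fixes M P :: "complex mat"
  assumes "M \<in> carrier_mat n m" "P \<in> carrier_mat n m"
    and "\<And>x. x \<in> carrier_vec m \<Longrightarrow> M *\<^sub>v x = P *\<^sub>v x"
  shows "M = P"
proof (rule eq_matI)
  fix i j assume "i < dim_row P" "j < dim_col P"
  then have ij: "i < n" "j < m" using assms by auto
  have "(M *\<^sub>v unit_vec m j) $ i = (P *\<^sub>v unit_vec m j) $ i" using assms(3) by simp
  then show "M $$ (i, j) = P $$ (i, j)" using ij assms(1,2) by simp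
qed (use assms in auto)

lemma hermitian_eigenvalue_real:
  fixes H :: "complex mat"
  assumes H: "H \<in> carrier_mat n n"
    and herm: "\<And>x y. \<lbrakk>x \<in> carrier_vec n; y \<in> carrier_vec n\<rbrakk> \<Longrightarrow> ip (H *\<^sub>v x) y = ip x (H *\<^sub>v y)"
    and e: "eigenvalue H e"
  shows "e \<in> \<real>"
proof -
  obtain x where x: "x \<in> carrier_vec n" "x \<noteq> 0\<^sub>v n" "H *\<^sub>v x = e \<cdot>\<^sub>v x"
    using e H by (auto simp: eigenvalue_def eigenvector_def)
  then have "e * ip x x = cnj e * ip x x"
    using herm[of x x] by (simp add: ip_smult_left ip_smult_right[of _ n])
  moreover have "ip x x \<noteq> 0"
    using x vec_norm_pos_iff[of x n] by (simp add: ip_self)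
  ultimately show ?thesis by (simp add: Reals_cnj_iff)
qed

text \<open>If it failed at \<open>x\<close>, the Rayleigh quotient \<open>s\<close> of
  \<open>H = B\<^sup>* B\<close> at \<open>x\<close> would lie below all eigenvalues of
  \<open>H\<close>. Then \<open>inertia_subspace\<close> makes \<open>H - s\<close> positive
  definite on the whole space, although its form vanishes at \<open>x\<close>.\<close>

lemma smallest_singular_value_le:
  assumes B: "B \<in> carrier_mat n m" and m: "1 \<le> m" and nonneg: "0 \<le> smallest_singular_value B"
    and x: "x \<in> carrier_vec m"
  shows "smallest_singular_value B * vec_norm x \<le> vec_norm (B *\<^sub>v x)"
proof (rule ccontr)
  let ?\<sigma> = "smallest_singular_value B"
  assume "\<not> ?thesis"
  then have less: "vec_norm (B *\<^sub>v x) < ?\<sigma> * vec_norm x" by simp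
  then have nx: "0 < vec_norm x"
    using vec_norm_nonneg[of "B *\<^sub>v x"] vec_norm_nonneg[of x]
    by (cases "vec_norm x = 0") (auto simp: less_le)
  define s where "s = (vec_norm (B *\<^sub>v x))\<^sup>2 / (vec_norm x)\<^sup>2"
  have "(vec_norm (B *\<^sub>v x))\<^sup>2 < (?\<sigma> * vec_norm x)\<^sup>2"
    using less by (intro power_strict_mono) auto
  then have s: "s < ?\<sigma>\<^sup>2" using nx by (simp add: s_def divide_less_eq power_mult_distrib)
  define H where "H = mat_adjoint B * B"
  have H: "H \<in> carrier_mat m m" unfolding H_def using B by (auto intro!: mult_carrier_mat)
  have Hv: "H *\<^sub>v z = mat_adjoint B *\<^sub>v (B *\<^sub>v z)" if "z \<in> carrier_vec m" for z
    unfolding H_def using that B by (intro assoc_mult_mat_vec[of _ m n _ m]) auto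
  have ipH: "ip (H *\<^sub>v z) w = ip (B *\<^sub>v z) (B *\<^sub>v w)" if "z \<in> carrier_vec m" "w \<in> carrier_vec m" for z w
    using that B ip_adjoint[OF mat_adjoint_carrier[OF B], of "B *\<^sub>v z" w]
    by (simp add: Hv mat_adjoint_adjoint[OF B])
  have herm: "ip (H *\<^sub>v z) w = ip z (H *\<^sub>v w)" if "z \<in> carrier_vec m" "w \<in> carrier_vec m" for z w
  proof -
    have "ip z (H *\<^sub>v w) = cnj (ip (H *\<^sub>v w) z)" using that H by (simp add: cnj_ip[of _ m])
    also have "\<dots> = ip (H *\<^sub>v z) w" using that B by (simp add: ipH cnj_ip[of _ n])
    finally show ?thesis ..
  qed
  obtain es where es: "char_poly H = (\<Prod>e\<leftarrow>es. [:- e, 1:])" "length es = m"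
    using char_poly_factorized[OF H] by blast
  have eig: "eigenvalue H e \<longleftrightarrow> e \<in> set es" for e
    unfolding eigenvalue_root_char_poly[OF H] es by (auto simp: poly_prod_list prod_list_zero_iff)
  have sv: "0 \<le> Re e \<and> singular_value B (sqrt (Re e))" if e: "e \<in> set es" for e
  proof -
    have ev: "eigenvalue H e" using e eig by simp
    then obtain z where z: "z \<in> carrier_vec m" "z \<noteq> 0\<^sub>v m" "H *\<^sub>v z = e \<cdot>\<^sub>v z"
      using H by (auto simp: eigenvalue_def eigenvector_def)
    have "e * of_real ((vec_norm z)\<^sup>2) = of_real ((vec_norm (B *\<^sub>v z))\<^sup>2)"
      using ipH[OF z(1) z(1)] z by (simp add: ip_smult_left ip_self)
    from arg_cong[OF this, of Re] have "Re e * (vec_norm z)\<^sup>2 = (vec_norm (B *\<^sub>v z))\<^sup>2"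
      by (simp only: Re_complex_of_real times_complex.simps Im_complex_of_real mult_zero_right diff_zero)
    moreover have "0 < (vec_norm z)\<^sup>2" using vec_norm_pos_iff[OF z(1)] z by simp
    ultimately have "0 \<le> Re e" by (metis zero_le_power2 zero_le_mult_iff less_le_not_le)
    moreover have "e = of_real (Re e)"
      using hermitian_eigenvalue_real[OF H herm ev] by (simp add: of_real_Re)
    ultimately show ?thesis using ev by (simp add: singular_value_def flip: H_def)
  qed
  \<comment> \<open>Finiteness gives \<open>Min\<close> in \<open>smallest_singular_value\<close>
    its meaning.\<close>
  have fin: "finite {s. singular_value B s}"
  proof (rule finite_subset)
    show "{s. singular_value B s} \<subseteq> (\<lambda>e. sqrt (Re e)) ` set es"
    proof
      fix s assume "s \<in> {s. singular_value B s}"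
      then have "0 \<le> s" "of_real (s\<^sup>2) \<in> set es"
        using eig by (auto simp: singular_value_def simp flip: H_def)
      then show "s \<in> (\<lambda>e. sqrt (Re e)) ` set es"
        by (intro image_eqI[of _ _ "of_real (s\<^sup>2)"]) auto
    qed
  qed simp
  have bound: "?\<sigma>\<^sup>2 \<le> Re e" if "e \<in> set es" for e
  proof -
    have "?\<sigma> \<le> sqrt (Re e)"
      unfolding smallest_singular_value_def using sv[OF that] fin by (intro Min_le) auto
    then have "?\<sigma>\<^sup>2 \<le> (sqrt (Re e))\<^sup>2" using nonneg by (intro power_mono)
    then show ?thesis using sv[OF that] by simp
  qed
  define G where "G = H - of_real s \<cdot>\<^sub>m 1\<^sub>m m"
  have G: "G \<in> carrier_mat m m" unfolding G_def by (intro minus_carrier_mat) auto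
  have Gv: "G *\<^sub>v z = H *\<^sub>v z - of_real s \<cdot>\<^sub>v z" if "z \<in> carrier_vec m" for z
    unfolding G_def using that H
    by (subst minus_mult_distrib_mat_vec[of _ m m]) (auto simp: smult_mat_mult_vec[of _ m m])
  have Gherm: "ip (G *\<^sub>v z) w = ip z (G *\<^sub>v w)" if "z \<in> carrier_vec m" "w \<in> carrier_vec m" for z w
    using that H herm[OF that]
    by (simp add: Gv ip_diff_left[of _ m] ip_diff_right[of _ m] ip_smult_left ip_smult_right[of _ m])
  have pos: "0 < Re (ip (G *\<^sub>v z) (H *\<^sub>v z + of_real (- s) \<cdot>\<^sub>v z))"
    if z: "z \<in> carrier_vec m" "z \<noteq> 0\<^sub>v m" for z
  proof -
    have eq: "H *\<^sub>v z + of_real (- s) \<cdot>\<^sub>v z = G *\<^sub>v z"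
      using z H by (subst Gv) auto
    have "G *\<^sub>v z \<noteq> 0\<^sub>v m"
    proof
      assume 0: "G *\<^sub>v z = 0\<^sub>v m"
      have "H *\<^sub>v z = G *\<^sub>v z + of_real s \<cdot>\<^sub>v z" using z H by (subst Gv) auto
      then have "H *\<^sub>v z = of_real s \<cdot>\<^sub>v z" using z 0 by simp
      then have "eigenvalue H (of_real s)"
        using z H by (auto simp: eigenvalue_def eigenvector_def)
      then show False using bound eig s by fastforce
    qed
    then show ?thesis
      unfolding eq using z G vec_norm_pos_iff[of "G *\<^sub>v z" m] by (simp add: ip_self)
  qed
  \<comment> \<open>All eigenvalues exceed \<open>s\<close>, so sign -1 selects every one and the
    subspace has dimension \<open>m\<close>.\<close>
  have "filter (\<lambda>e. - 1 * (Re e + - s) < 0) es = es"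
    using bound s by (intro filter_True) fastforce
  then have len: "m = length (filter (\<lambda>e. - 1 * (Re e + - s) < 0) es)" using es by simp
  have minus_one: "(- 1 :: real)\<^sup>2 = 1" by simp
  from inertia_subspace[OF H es(1) minus_one len G Gherm pos] obtain W where
    W: "W \<in> carrier_mat m m" and GW: "\<forall>w \<in> carrier_vec m. w \<noteq> 0\<^sub>v m \<longrightarrow>
      W *\<^sub>v w \<noteq> 0\<^sub>v m \<and> - 1 * Re (ip (G *\<^sub>v (W *\<^sub>v w)) (W *\<^sub>v w)) < 0"
    by (rule bexE)
  \<comment> \<open>The square matrix \<open>W\<close> is injective, hence onto, so \<open>x\<close>
    itself is in its range.\<close>
  have Winj: "w = 0\<^sub>v m" if "w \<in> carrier_vec m" "W *\<^sub>v w = 0\<^sub>v m" for w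
    using GW that by blast
  obtain R where R: "R \<in> carrier_mat m m" "W * R = 1\<^sub>m m"
    using invertible_matI[OF W Winj] by blast
  have "W *\<^sub>v (R *\<^sub>v x) = x" using R W x by (simp flip: assoc_mult_mat_vec)
  moreover have "R *\<^sub>v x \<noteq> 0\<^sub>v m"
  proof
    assume "R *\<^sub>v x = 0\<^sub>v m"
    then have "x = W *\<^sub>v 0\<^sub>v m" using \<open>W *\<^sub>v (R *\<^sub>v x) = x\<close> by simp
    then have "x = 0\<^sub>v m" using W by auto
    then show False using nx by (simp add: vec_norm_def)
  qed
  ultimately have "0 < Re (ip (G *\<^sub>v x) x)"
    using bspec[OF GW, of "R *\<^sub>v x"] R x by simp
  also have "Re (ip (G *\<^sub>v x) x) = (vec_norm (B *\<^sub>v x))\<^sup>2 - s * (vec_norm x)\<^sup>2"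
    using x H ipH[OF x x] by (simp add: Gv ip_diff_left[of _ m] ip_smult_left ip_self)
  also have "\<dots> = 0" using nx by (simp add: s_def)
  finally show False by simp
qed

text \<open>In \<open>lyapunov_pos\<close>, \<open>s\<close> and \<open>t\<close> are the norms of
  the components of a vector in \<open>ker B\<^sup>*\<close> and in the range of \<open>B\<close>.
  If \<open>s\<close> is relatively large the bound on \<open>z\<close> suffices, otherwise the term
  \<open>8 h\<^sup>2 t\<^sup>2\<close> alone does.\<close>

lemma scalar_estimate:
  fixes h s t z :: real
  assumes h: "0 < h" and st: "0 \<le> s" "0 \<le> t" "0 < s + t" and z: "0 \<le> z" "h * (5 / 2 * s - t) \<le> z"
  shows "2 * (3 / 2 * h)\<^sup>2 * (s\<^sup>2 + t\<^sup>2) < z\<^sup>2 + 8 * h\<^sup>2 * t\<^sup>2"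
proof (cases "t \<le> 5 / 2 * s")
  case True
  \<comment> \<open>Four times the difference of the two sides, divided by \<open>h\<^sup>2\<close>,
    with \<open>z\<close> at its lower bound. The discriminant \<open>400 - 504\<close> is
    negative.\<close>
  have "0 < 7 * s\<^sup>2 - 20 * s * t + 18 * t\<^sup>2"
  proof -
    have eq: "7 * s\<^sup>2 - 20 * s * t + 18 * t\<^sup>2 = 7 * (s - 10 / 7 * t)\<^sup>2 + 26 / 7 * t\<^sup>2"
      by (simp add: power2_eq_square field_simps)
    show ?thesis
    proof (cases "t = 0")
      case True
      then show ?thesis using st by simp
    next
      case False
      then have "0 < 26 / 7 * t\<^sup>2" by simp
      then show ?thesis unfolding eq by (intro add_nonneg_pos) auto
    qed
  qed
  then have "0 < h\<^sup>2 * (7 * s\<^sup>2 - 20 * s * t + 18 * t\<^sup>2)" using h by simp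
  moreover have "(h * (5 / 2 * s - t))\<^sup>2 \<le> z\<^sup>2"
    using z h True by (intro power_mono mult_nonneg_nonneg) auto
  ultimately show ?thesis by (simp add: power2_eq_square algebra_simps)
next
  case False
  then have "(5 / 2 * s)\<^sup>2 \<le> t\<^sup>2" using st by (intro power_mono) auto
  moreover have "0 < t\<^sup>2" using False st by auto
  ultimately have "9 / 2 * s\<^sup>2 + 9 / 2 * t\<^sup>2 < 8 * t\<^sup>2" by (simp add: power2_eq_square)
  then have "h\<^sup>2 * (9 / 2 * s\<^sup>2 + 9 / 2 * t\<^sup>2) < h\<^sup>2 * (8 * t\<^sup>2)" using h by (intro mult_strict_left_mono) auto
  moreover have "2 * (3 / 2 * h)\<^sup>2 * (s\<^sup>2 + t\<^sup>2) = h\<^sup>2 * (9 / 2 * s\<^sup>2 + 9 / 2 * t\<^sup>2)"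
    by (simp add: power2_eq_square field_simps)
  moreover have "0 \<le> z\<^sup>2" by simp
  ultimately show ?thesis by linarith
qed

section \<open>Form estimates and dimension count for a large smallest singular value\<close>

lemma mult_mat_vec_zero: "M \<in> carrier_mat n m \<Longrightarrow> M *\<^sub>v 0\<^sub>v m = (0\<^sub>v n :: complex vec)"
  by (intro eq_vecI) auto

text \<open>The parameter \<open>h\<close> stands for \<open>\<sigma> / (2 \<surd>2)\<close>;
  \<open>lower\<close> is then \<open>\<sigma> \<parallel>w\<parallel> \<le> \<parallel>B
  w\<parallel>\<close> squared.\<close>

locale riccati_large = riccati +
  fixes h :: real
  assumes h: "0 < h" and spread: "l n - l 1 \<le> h"
    and lower: "\<And>w. w \<in> carrier_vec m \<Longrightarrow> 8 * h\<^sup>2 * (vec_norm w)\<^sup>2 \<le> (vec_norm (B *\<^sub>v w))\<^sup>2"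
begin

text \<open>Centring \<open>A\<close> at the midpoint of its spectrum brings its norm down to at
  most \<open>h / 2\<close>.\<close>

definition shift :: "complex vec \<Rightarrow> complex vec" where
  "shift y = A *\<^sub>v y - (\<i> * of_real ((l 1 + l n) / 2)) \<cdot>\<^sub>v y"

lemma shift_carrier [simp]: "y \<in> carrier_vec n \<Longrightarrow> shift y \<in> carrier_vec n"
  by (simp add: shift_def)

lemma norm_shift_le:
  assumes y: "y \<in> carrier_vec n"
  shows "vec_norm (shift y) \<le> h / 2 * vec_norm y"
proof -
  have "(vec_norm (shift y))\<^sup>2 = (\<Sum>j\<in>{1..n}. (cmod (ip (shift y) (v j)))\<^sup>2)"
    using y by (intro vec_norm_eigenbasis[OF basis]) simp
  also have "\<dots> \<le> (\<Sum>j\<in>{1..n}. (h / 2)\<^sup>2 * (cmod (ip y (v j)))\<^sup>2)"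
  proof (rule sum_mono)
    fix j assume j: "j \<in> {1..n}"
    have "ip (shift y) (v j) = \<i> * of_real (l j - (l 1 + l n) / 2) * ip y (v j)"
      using y j by (simp add: shift_def ip_diff_left[of _ n] ip_smult_left coef_A algebra_simps)
    then have "cmod (ip (shift y) (v j)) = \<bar>l j - (l 1 + l n) / 2\<bar> * cmod (ip y (v j))"
      by (simp only: norm_mult norm_of_real norm_ii)
    also have "\<dots> \<le> h / 2 * cmod (ip y (v j))"
      using spread eigenvalues_mono[of 1 j] eigenvalues_mono[of j n] j
      by (intro mult_right_mono) (auto simp: abs_le_iff field_simps)
    finally have "(cmod (ip (shift y) (v j)))\<^sup>2 \<le> (h / 2 * cmod (ip y (v j)))\<^sup>2"
      by (intro power_mono) auto
    then show "(cmod (ip (shift y) (v j)))\<^sup>2 \<le> (h / 2)\<^sup>2 * (cmod (ip y (v j)))\<^sup>2"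
      by (simp only: power_mult_distrib)
  qed
  also have "\<dots> = (h / 2 * vec_norm y)\<^sup>2"
    unfolding power_mult_distrib vec_norm_eigenbasis[OF basis y] sum_distrib_left ..
  finally show ?thesis by (rule power2_le_imp_le) (use h in auto)
qed

text \<open>Because \<open>\<langle>Y y, y\<rangle>\<close> is real, the imaginary shift leaves
  \<open>Re \<langle>Y y, A y\<rangle>\<close> unchanged, and \<open>norm_adjoint_B\<close>
  completes the square.\<close>

lemma norm_shifted:
  assumes y: "y \<in> carrier_vec n"
  shows "(vec_norm (Y *\<^sub>v y - shift y))\<^sup>2 = (vec_norm (mat_adjoint B *\<^sub>v y))\<^sup>2 + (vec_norm (shift y))\<^sup>2"
proof -
  have "Im (ip (Y *\<^sub>v y) y) = 0"
    using cnj_ip[of y n "Y *\<^sub>v y"] herm[of y y] y by (simp add: complex_eq_iff)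
  then have "Re (ip (Y *\<^sub>v y) (shift y)) = Re (ip (Y *\<^sub>v y) (A *\<^sub>v y))"
    using y by (simp add: shift_def ip_diff_right[of _ n] ip_smult_right[of _ n])
  then show ?thesis
    using y by (simp add: vec_norm_diff_sq[of _ n] norm_adjoint_B)
qed

lemma Re_shift:
  assumes y: "y \<in> carrier_vec n"
  shows "Re (ip (shift y) y) = 0"
  using y Re_skew[OF y] by (simp add: shift_def ip_diff_left[of _ n] ip_smult_left ip_self)

text \<open>On the kernel \<open>norm_shifted\<close> reads \<open>\<parallel>Y y - shift
  y\<parallel> = \<parallel>shift y\<parallel> \<le> h / 2 \<parallel>y\<parallel>\<close>. The form
  bound gains a factor 2 because \<open>\<langle>shift y, y\<rangle>\<close> is imaginary.\<close>

lemma kernel_bounds: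
  assumes y: "y \<in> carrier_vec n" and ker: "mat_adjoint B *\<^sub>v y = 0\<^sub>v m"
  shows "vec_norm (Y *\<^sub>v y) \<le> h * vec_norm y" "Re (ip (Y *\<^sub>v y) y) \<le> h / 2 * (vec_norm y)\<^sup>2"
proof -
  have "(vec_norm (Y *\<^sub>v y - shift y))\<^sup>2 = (vec_norm (shift y))\<^sup>2"
    using norm_shifted[OF y] ker by (simp add: vec_norm_def)
  then have eq: "vec_norm (Y *\<^sub>v y - shift y) = vec_norm (shift y)" by simp
  show "vec_norm (Y *\<^sub>v y) \<le> h * vec_norm y"
    using vec_norm_triangle_diff[of "Y *\<^sub>v y" n "shift y"] eq norm_shift_le[OF y] y by simp
  have "Re (ip (Y *\<^sub>v y) y) = Re (ip (Y *\<^sub>v y - shift y) y)"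
    using y Re_shift[OF y] by (simp add: ip_diff_left[of _ n])
  also have "\<dots> \<le> vec_norm (shift y) * vec_norm y"
    unfolding eq[symmetric] using y by (intro Re_ip_le[of _ n]) auto
  also have "\<dots> \<le> h / 2 * vec_norm y * vec_norm y"
    by (intro mult_right_mono norm_shift_le y) simp
  finally show "Re (ip (Y *\<^sub>v y) y) \<le> h / 2 * (vec_norm y)\<^sup>2"
    by (simp add: power2_eq_square)
qed

text \<open>Transfers \<open>lower\<close> to the adjoint: \<open>\<parallel>B w\<parallel>\<^sup>2
  = \<langle>w, B\<^sup>* B w\<rangle>\<close> is at most
  \<open>\<parallel>w\<parallel> \<parallel>B\<^sup>* B w\<parallel>\<close>, and
  \<open>lower\<close> bounds \<open>\<parallel>w\<parallel>\<close> by
  \<open>\<parallel>B w\<parallel>\<close>.\<close>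

lemma range_adjoint_bound:
  assumes w: "w \<in> carrier_vec m"
  shows "8 * h\<^sup>2 * (vec_norm (B *\<^sub>v w))\<^sup>2 \<le> (vec_norm (mat_adjoint B *\<^sub>v (B *\<^sub>v w)))\<^sup>2"
proof (cases "vec_norm (B *\<^sub>v w) = 0")
  case False
  define \<beta> where "\<beta> = vec_norm (mat_adjoint B *\<^sub>v (B *\<^sub>v w))"
  define \<gamma> where "\<gamma> = (vec_norm (B *\<^sub>v w))\<^sup>2"
  have \<gamma>: "0 < \<gamma>" using False by (simp add: \<gamma>_def)
  have "\<gamma> = Re (ip w (mat_adjoint B *\<^sub>v (B *\<^sub>v w)))"
    using w by (simp add: \<gamma>_def ip_self flip: ip_B)
  also have "\<dots> \<le> vec_norm w * \<beta>"
    unfolding \<beta>_def using w by (intro Re_ip_le[of _ m]) auto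
  finally have "\<gamma>\<^sup>2 \<le> (vec_norm w)\<^sup>2 * \<beta>\<^sup>2"
    using \<gamma> by (metis power_mono less_imp_le power_mult_distrib)
  then have "8 * h\<^sup>2 * \<gamma>\<^sup>2 \<le> 8 * h\<^sup>2 * ((vec_norm w)\<^sup>2 * \<beta>\<^sup>2)"
    by (intro mult_left_mono) auto
  also have "\<dots> \<le> \<gamma> * \<beta>\<^sup>2"
    using mult_right_mono[OF lower[OF w], of "\<beta>\<^sup>2"] by (simp add: \<gamma>_def mult.assoc)
  finally have "\<gamma> * (8 * h\<^sup>2 * \<gamma>) \<le> \<gamma> * \<beta>\<^sup>2" by (simp add: power2_eq_square mult_ac)
  then show ?thesis using \<gamma> by (simp add: \<beta>_def \<gamma>_def)
qed simp

text \<open>Since \<open>25 / 4 \<le> 8\<close>, \<open>norm_shifted\<close> gives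
  \<open>5 / 2 h\<close> for \<open>Y - shift\<close>, and removing the shift costs
  \<open>h / 2\<close>.\<close>

lemma range_lower:
  assumes w: "w \<in> carrier_vec m"
  shows "2 * h * vec_norm (B *\<^sub>v w) \<le> vec_norm (Y *\<^sub>v (B *\<^sub>v w))"
proof -
  let ?y = "B *\<^sub>v w"
  have y: "?y \<in> carrier_vec n" using w by simp
  have "(5 / 2 * h * vec_norm ?y)\<^sup>2 \<le> 8 * h\<^sup>2 * (vec_norm ?y)\<^sup>2"
    using zero_le_power2[of "h * vec_norm ?y"] by (simp add: power_mult_distrib power2_eq_square mult_ac)
  also have "\<dots> \<le> (vec_norm (Y *\<^sub>v ?y - shift ?y))\<^sup>2"
    using range_adjoint_bound[OF w] norm_shifted[OF y] by (simp add: add_increasing2)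
  finally have "5 / 2 * h * vec_norm ?y \<le> vec_norm (Y *\<^sub>v ?y - shift ?y)"
    by (rule power2_le_imp_le) simp
  moreover have "vec_norm (Y *\<^sub>v ?y - shift ?y) \<le> vec_norm (Y *\<^sub>v ?y) + vec_norm (shift ?y)"
    using y by (intro vec_norm_triangle_sub[of _ n]) auto
  ultimately show ?thesis using norm_shift_le[OF y] by simp
qed

text \<open>Orthogonal projection onto the range of \<open>B\<close>, with least-squares
  coefficients \<open>w = (B\<^sup>* B)\<^sup>-\<^sup>1 B\<^sup>* y\<close>.\<close>

lemma decompose:
  assumes y: "y \<in> carrier_vec n"
  obtains y0 w where "y0 \<in> carrier_vec n" "w \<in> carrier_vec m" "y = y0 + B *\<^sub>v w"
    "mat_adjoint B *\<^sub>v y0 = 0\<^sub>v m"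
proof -
  define H where "H = mat_adjoint B * B"
  have H: "H \<in> carrier_mat m m" unfolding H_def by (auto intro!: mult_carrier_mat mat_adjoint_carrier[OF B])
  have Hv: "H *\<^sub>v z = mat_adjoint B *\<^sub>v (B *\<^sub>v z)" if "z \<in> carrier_vec m" for z
    unfolding H_def using that by (intro assoc_mult_mat_vec[OF mat_adjoint_carrier[OF B] B])
  have "z = 0\<^sub>v m" if z: "z \<in> carrier_vec m" "H *\<^sub>v z = 0\<^sub>v m" for z
  proof -
    have "mat_adjoint B *\<^sub>v (B *\<^sub>v z) = 0\<^sub>v m" using Hv z by simp
    then have "8 * h\<^sup>2 * (vec_norm (B *\<^sub>v z))\<^sup>2 \<le> 0" using range_adjoint_bound[OF z(1)] by (simp add: vec_norm_def)
    then have "(vec_norm (B *\<^sub>v z))\<^sup>2 = 0" using h by (simp add: mult_le_0_iff)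
    then have "8 * h\<^sup>2 * (vec_norm z)\<^sup>2 \<le> 0" using lower[OF z(1)] by simp
    then have "(vec_norm z)\<^sup>2 = 0" using h by (simp add: mult_le_0_iff)
    then show ?thesis using vec_norm_eq_0_iff[OF z(1)] by simp
  qed
  then obtain R where R: "R \<in> carrier_mat m m" "H * R = 1\<^sub>m m"
    using invertible_matI[OF H] by blast
  let ?w = "R *\<^sub>v (mat_adjoint B *\<^sub>v y)"
  have w: "?w \<in> carrier_vec m" using R y by simp
  have "H *\<^sub>v ?w = mat_adjoint B *\<^sub>v y" using R H y by (simp flip: assoc_mult_mat_vec)
  then have "mat_adjoint B *\<^sub>v (y - B *\<^sub>v ?w) = 0\<^sub>v m"
    using y w Hv[OF w] by (simp add: mult_minus_distrib_mat_vec[OF mat_adjoint_carrier[OF B]])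
  moreover have "y = (y - B *\<^sub>v ?w) + B *\<^sub>v ?w"
    using y carrier_vecD[OF vecs(4)[OF w]] by (intro eq_vecI) auto
  ultimately show thesis using that[of "y - B *\<^sub>v ?w" ?w] y w by simp
qed

text \<open>By \<open>norm_adjoint_B\<close> the expression equals \<open>2 Re \<langle>(t - Y) y, (A - Y + t) y\<rangle>\<close>.\<close>

lemma lyapunov_pos:
  assumes y: "y \<in> carrier_vec n" "y \<noteq> 0\<^sub>v n"
  defines "t \<equiv> 3 / 2 * h"
  shows "0 < 2 * (vec_norm (Y *\<^sub>v y - of_real t \<cdot>\<^sub>v y))\<^sup>2 + (vec_norm (mat_adjoint B *\<^sub>v y))\<^sup>2 - (vec_norm (Y *\<^sub>v y))\<^sup>2"
proof -
  obtain y0 w where y0: "y0 \<in> carrier_vec n" and w: "w \<in> carrier_vec m"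
    and split: "y = y0 + B *\<^sub>v w" and ker: "mat_adjoint B *\<^sub>v y0 = 0\<^sub>v m"
    using decompose[OF y(1)] by blast
  define y1 where "y1 = B *\<^sub>v w"
  have y1: "y1 \<in> carrier_vec n" using w by (simp add: y1_def)
  define n0 n1 where "n0 = vec_norm y0" and "n1 = vec_norm y1"
  have orth: "ip y1 y0 = 0" using w y0 ker by (simp add: y1_def ip_B)
  then have orth': "ip y0 y1 = 0" using cnj_ip[OF y1 y0] by simp
  have "ip y y = ip y0 y0 + ip y1 y1"
    using y0 y1 orth orth' by (simp add: split ip_add_left[of _ n] ip_add_right[of _ n] flip: y1_def)
  then have "complex_of_real ((vec_norm y)\<^sup>2) = of_real (n0\<^sup>2 + n1\<^sup>2)"
    by (simp only: ip_self of_real_add n0_def n1_def)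
  then have ny: "(vec_norm y)\<^sup>2 = n0\<^sup>2 + n1\<^sup>2" by (simp only: of_real_eq_iff)
  have "mat_adjoint B *\<^sub>v y = mat_adjoint B *\<^sub>v y1"
    using y0 y1 ker carrier_vecD[OF vecs(3)[OF y1]] 
    by (simp add: split mult_add_distrib_mat_vec[OF mat_adjoint_carrier[OF B]] flip: y1_def)
  then have By: "8 * h\<^sup>2 * n1\<^sup>2 \<le> (vec_norm (mat_adjoint B *\<^sub>v y))\<^sup>2"
    using range_adjoint_bound[OF w] by (simp add: y1_def n1_def)
  \<comment> \<open>The point \<open>2 t\<close> comes from \<open>2 \<parallel>Y y - t
    y\<parallel>\<^sup>2 - \<parallel>Y y\<parallel>\<^sup>2 = \<parallel>Y y - 2 t
    y\<parallel>\<^sup>2 - 2 t\<^sup>2 \<parallel>y\<parallel>\<^sup>2\<close>.\<close>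
  define z where "z = vec_norm (Y *\<^sub>v y - of_real (2 * t) \<cdot>\<^sub>v y)"
  \<comment> \<open>Test \<open>2 t y - Y y\<close> against \<open>y0\<close>: the first term gives
    \<open>3 h n0\<^sup>2\<close>, and \<open>kernel_bounds\<close> limits the loss to
    \<open>h / 2 n0\<^sup>2 + h n0 n1\<close>.\<close>
  have "n0 * (h * (5 / 2 * n0 - n1)) \<le> n0 * z"
  proof -
    have yy0: "ip y y0 = of_real (n0\<^sup>2)"
      using y0 y1 orth by (simp add: split ip_add_left[of _ n] ip_self n0_def flip: y1_def)
    have "Re (ip (Y *\<^sub>v y) y0) = Re (ip (Y *\<^sub>v y0) y0) + Re (ip y1 (Y *\<^sub>v y0))"
      using y y0 y1 Re_ip_commute[of y0 n "Y *\<^sub>v y0"] herm[OF y(1) y0]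
      by (simp add: split ip_add_left[of _ n] flip: y1_def)
    also have "\<dots> \<le> h / 2 * n0\<^sup>2 + n1 * (h * n0)"
    proof (rule add_mono)
      show "Re (ip (Y *\<^sub>v y0) y0) \<le> h / 2 * n0\<^sup>2"
        using kernel_bounds(2)[OF y0 ker] by (simp add: n0_def)
      have "Re (ip y1 (Y *\<^sub>v y0)) \<le> n1 * vec_norm (Y *\<^sub>v y0)"
        unfolding n1_def using y0 y1 by (intro Re_ip_le[of _ n]) auto
      also have "\<dots> \<le> n1 * (h * n0)"
        unfolding n0_def by (intro mult_left_mono kernel_bounds(1)[OF y0 ker]) (simp add: n1_def)
      finally show "Re (ip y1 (Y *\<^sub>v y0)) \<le> n1 * (h * n0)" .
    qed
    finally have le: "Re (ip (Y *\<^sub>v y) y0) \<le> h / 2 * n0\<^sup>2 + n1 * (h * n0)" .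
    have "2 * t * n0\<^sup>2 - Re (ip (Y *\<^sub>v y) y0) = - Re (ip (Y *\<^sub>v y - of_real (2 * t) \<cdot>\<^sub>v y) y0)"
      using y y0 by (simp add: ip_diff_left[of _ n] ip_smult_left yy0)
    also have "\<dots> \<le> z * n0"
      unfolding z_def n0_def using norm_ip_le[of "Y *\<^sub>v y - of_real (2 * t) \<cdot>\<^sub>v y" n y0] y y0
        abs_Re_le_cmod[of "ip (Y *\<^sub>v y - of_real (2 * t) \<cdot>\<^sub>v y) y0"] by simp
    finally show ?thesis using le by (simp add: t_def algebra_simps power2_eq_square)
  qed
  then have "h * (5 / 2 * n0 - n1) \<le> z"
  proof (cases "n0 = 0")
    case True
    then have "h * (5 / 2 * n0 - n1) \<le> 0" using h by (simp add: n1_def)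
    then show ?thesis using vec_norm_nonneg order_trans unfolding z_def by blast
  qed (simp add: n0_def mult_le_cancel_left less_le)
  moreover have "0 < n0 + n1"
  proof -
    have "0 < n0\<^sup>2 + n1\<^sup>2" using ny vec_norm_pos_iff[OF y(1)] y(2) by (metis zero_less_power)
    then show ?thesis by (smt (verit) n0_def n1_def vec_norm_nonneg zero_power2)
  qed
  ultimately have "2 * t\<^sup>2 * (n0\<^sup>2 + n1\<^sup>2) < z\<^sup>2 + 8 * h\<^sup>2 * n1\<^sup>2"
    unfolding t_def by (intro scalar_estimate h) (auto simp: z_def n0_def n1_def)
  then have pos: "0 < z\<^sup>2 - 2 * t\<^sup>2 * (vec_norm y)\<^sup>2 + (vec_norm (mat_adjoint B *\<^sub>v y))\<^sup>2"
    using By by (simp add: ny)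
  have "z\<^sup>2 = (vec_norm (Y *\<^sub>v y))\<^sup>2 - 2 * (2 * t) * Re (ip (Y *\<^sub>v y) y) + (2 * t)\<^sup>2 * (vec_norm y)\<^sup>2"
    unfolding z_def using y by (subst vec_norm_diff_sq[of _ n])
      (auto simp: ip_smult_right[of _ n] vec_norm_smult power_mult_distrib)
  moreover have "(vec_norm (Y *\<^sub>v y - of_real t \<cdot>\<^sub>v y))\<^sup>2
    = (vec_norm (Y *\<^sub>v y))\<^sup>2 - 2 * t * Re (ip (Y *\<^sub>v y) y) + t\<^sup>2 * (vec_norm y)\<^sup>2"
    using y by (subst vec_norm_diff_sq[of _ n])
      (auto simp: ip_smult_right[of _ n] vec_norm_smult power_mult_distrib)
  ultimately show ?thesis using pos by (simp add: power2_eq_square algebra_simps)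
qed

text \<open>For such an eigenvector \<open>\<langle>Y x, A x\<rangle>\<close> is imaginary, so by
  \<open>norm_adjoint_B\<close> the expression in \<open>lyapunov_pos\<close> would be 0.\<close>

lemma Y_not_eigenvalue:
  assumes x: "x \<in> carrier_vec n" "x \<noteq> 0\<^sub>v n"
  shows "Y *\<^sub>v x - of_real (3 / 2 * h) \<cdot>\<^sub>v x \<noteq> 0\<^sub>v n"
proof
  assume 0: "Y *\<^sub>v x - of_real (3 / 2 * h) \<cdot>\<^sub>v x = 0\<^sub>v n"
  have "Y *\<^sub>v x = (Y *\<^sub>v x - of_real (3 / 2 * h) \<cdot>\<^sub>v x) + of_real (3 / 2 * h) \<cdot>\<^sub>v x"
    using x carrier_vecD[OF vecs(2)[OF x(1)]] by (intro eq_vecI) auto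
  then have Yx: "Y *\<^sub>v x = of_real (3 / 2 * h) \<cdot>\<^sub>v x" using 0 x by simp
  have "Re (ip x (A *\<^sub>v x)) = 0" using Re_skew[OF x(1)] Re_ip_commute[of x n "A *\<^sub>v x"] x by simp
  then have "Re (ip (Y *\<^sub>v x) (A *\<^sub>v x)) = 0" by (simp add: Yx ip_smult_left)
  then have "(vec_norm (mat_adjoint B *\<^sub>v x))\<^sup>2 = (vec_norm (Y *\<^sub>v x))\<^sup>2"
    using norm_adjoint_B[OF x(1)] by simp
  then have "0 < 2 * (vec_norm (0\<^sub>v n))\<^sup>2" using lyapunov_pos[OF x] by (simp only: 0)
  then show False by (simp add: vec_norm_def)
qed

text \<open>\<open>r1\<close>, \<open>r2\<close> count eigenvalues of \<open>A - Y\<close> left and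
  right of \<open>Re z = - t\<close>, and \<open>q1\<close>, \<open>q2\<close> those of
  \<open>Y\<close> below and above \<open>t\<close>. From \<open>r1 \<le> m\<close> and
  \<open>r2 \<le> n - q2 = q1 \<le> n - m\<close>, together with \<open>r1 + r2 = n\<close>, both
  counts follow.\<close>

lemma closed_loop_split:
  assumes "m \<le> n" and es: "char_poly (A - Y) = (\<Prod>e\<leftarrow>es. [:- e, 1:])" "length es = n"
    and line: "\<And>e. e \<in> set es \<Longrightarrow> Re e \<noteq> - (3 / 2 * h)"
  shows "length (filter (\<lambda>e. Re e < - (3 / 2 * h)) es) = m"
    and "length (filter (\<lambda>e. - (3 / 2 * h) < Re e) es) = n - m"
proof -
  define t where "t = 3 / 2 * h"
  have t: "0 < t" using h by (simp add: t_def)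
  \<comment> \<open>\<open>K\<close> is the form for \<open>A - Y\<close>; its negative
    \<open>G\<close> and \<open>F = Y\<^sup>2 - t\<^sup>2\<close> are forms for
    \<open>Y\<close>.\<close>
  define K where "K = of_real t \<cdot>\<^sub>m 1\<^sub>m n - Y"
  define G where "G = Y - of_real t \<cdot>\<^sub>m 1\<^sub>m n"
  define F where "F = Y * Y - of_real (t\<^sup>2) \<cdot>\<^sub>m 1\<^sub>m n"
  have N: "A - Y \<in> carrier_mat n n" and K: "K \<in> carrier_mat n n" and G: "G \<in> carrier_mat n n"
    and F: "F \<in> carrier_mat n n"
    unfolding K_def G_def F_def by (auto intro!: minus_carrier_mat)
  have Nv: "(A - Y) *\<^sub>v x = A *\<^sub>v x - Y *\<^sub>v x" if "x \<in> carrier_vec n" for x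
    using that by (intro minus_mult_distrib_mat_vec[of _ n n]) auto
  have Iv: "(c \<cdot>\<^sub>m 1\<^sub>m n) *\<^sub>v x = c \<cdot>\<^sub>v x" if "x \<in> carrier_vec n" for c :: complex and x
    using that by (simp add: smult_mat_mult_vec[of _ n n])
  have Kv: "K *\<^sub>v x = of_real t \<cdot>\<^sub>v x - Y *\<^sub>v x" if "x \<in> carrier_vec n" for x
    unfolding K_def using that by (subst minus_mult_distrib_mat_vec[of _ n n]) (auto simp: Iv)
  have Gv: "G *\<^sub>v x = Y *\<^sub>v x - of_real t \<cdot>\<^sub>v x" if "x \<in> carrier_vec n" for x
    unfolding G_def using that by (subst minus_mult_distrib_mat_vec[of _ n n]) (auto simp: Iv)
  have Fv: "F *\<^sub>v x = Y *\<^sub>v (Y *\<^sub>v x) - of_real (t\<^sup>2) \<cdot>\<^sub>v x" if "x \<in> carrier_vec n" for x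
    unfolding F_def using that
    by (subst minus_mult_distrib_mat_vec[of _ n n])
      (auto simp: Iv assoc_mult_mat_vec[OF Y Y] mult_carrier_mat[OF Y Y] simp del: of_real_power)
  have real_Y: "Re (ip (G *\<^sub>v x) x) = - Re (ip (K *\<^sub>v x) x)" if "x \<in> carrier_vec n" for x
    using that by (simp add: Kv Gv ip_diff_left[of _ n])
  have hermK: "ip (K *\<^sub>v x) y = ip x (K *\<^sub>v y)" if "x \<in> carrier_vec n" "y \<in> carrier_vec n" for x y
    using that herm[OF that]
    by (simp add: Kv ip_diff_left[of _ n] ip_diff_right[of _ n] ip_smult_left ip_smult_right[of _ n])
  have hermG: "ip (G *\<^sub>v x) y = ip x (G *\<^sub>v y)" if "x \<in> carrier_vec n" "y \<in> carrier_vec n" for x y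
    using that herm[OF that]
    by (simp add: Gv ip_diff_left[of _ n] ip_diff_right[of _ n] ip_smult_left ip_smult_right[of _ n])
  have hermF: "ip (F *\<^sub>v x) y = ip x (F *\<^sub>v y)" if "x \<in> carrier_vec n" "y \<in> carrier_vec n" for x y
    using that herm[of "Y *\<^sub>v x" y] herm[of x "Y *\<^sub>v y"]
    by (simp add: Fv ip_diff_left[of _ n] ip_diff_right[of _ n] ip_smult_left ip_smult_right[of _ n])
  \<comment> \<open>The second argument is \<open>K x + A x\<close>, and
    \<open>\<langle>t x, A x\<rangle>\<close> is imaginary; by \<open>norm_adjoint_B\<close> the
    real part is half the expression in \<open>lyapunov_pos\<close>.\<close>
  have posK: "0 < Re (ip (K *\<^sub>v x) ((A - Y) *\<^sub>v x + of_real t \<cdot>\<^sub>v x))"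
    if x: "x \<in> carrier_vec n" "x \<noteq> 0\<^sub>v n" for x
  proof -
    have eq: "(A - Y) *\<^sub>v x + of_real t \<cdot>\<^sub>v x = K *\<^sub>v x + A *\<^sub>v x"
      using x carrier_vecD[OF vecs(1)[OF x(1)]] carrier_vecD[OF vecs(2)[OF x(1)]]
      by (intro eq_vecI) (auto simp: Nv Kv)
    have "Re (ip x (A *\<^sub>v x)) = 0" using Re_skew[OF x(1)] Re_ip_commute[of x n "A *\<^sub>v x"] x by simp
    then have "Re (ip (K *\<^sub>v x) (K *\<^sub>v x + A *\<^sub>v x)) = (vec_norm (K *\<^sub>v x))\<^sup>2 - Re (ip (Y *\<^sub>v x) (A *\<^sub>v x))"
      using x K by (simp add: ip_add_right[of _ n] ip_self) (simp add: Kv ip_diff_left[of _ n] ip_smult_left)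
    moreover have "vec_norm (K *\<^sub>v x) = vec_norm (Y *\<^sub>v x - of_real t \<cdot>\<^sub>v x)"
      using x by (simp add: Kv vec_norm_minus_commute[of _ n])
    ultimately show ?thesis
      unfolding eq using lyapunov_pos[OF x] norm_adjoint_B[OF x(1)] by (simp add: t_def)
  qed
  have shiftY: "Y *\<^sub>v x + of_real (- t) \<cdot>\<^sub>v x = G *\<^sub>v x" if "x \<in> carrier_vec n" for x
    using that carrier_vecD[OF vecs(2)[OF that]] by (intro eq_vecI) (auto simp: Gv)
  have G0: "G *\<^sub>v x \<noteq> 0\<^sub>v n" if "x \<in> carrier_vec n" "x \<noteq> 0\<^sub>v n" for x
    using Y_not_eigenvalue[OF that] that by (simp add: Gv t_def)
  have normG: "0 < (vec_norm (G *\<^sub>v x))\<^sup>2" if "x \<in> carrier_vec n" "x \<noteq> 0\<^sub>v n" for x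
    using G0[OF that] vec_norm_pos_iff[of "G *\<^sub>v x" n] that G by simp
  have posG: "0 < Re (ip (G *\<^sub>v x) (Y *\<^sub>v x + of_real (- t) \<cdot>\<^sub>v x))"
    if x: "x \<in> carrier_vec n" "x \<noteq> 0\<^sub>v n" for x
    using normG[OF x] by (simp only: shiftY[OF x(1)] ip_self Re_complex_of_real)
  have posF: "0 < Re (ip (F *\<^sub>v x) (Y *\<^sub>v x + of_real (- t) \<cdot>\<^sub>v x))"
    if x: "x \<in> carrier_vec n" "x \<noteq> 0\<^sub>v n" for x
  proof -
    \<comment> \<open>Factor \<open>F = (Y + t) (Y - t)\<close>: with \<open>z = (Y - t) x\<close>
      the form is
      \<open>\<langle>Y z, z\<rangle> + t \<parallel>z\<parallel>\<^sup>2\<close>.\<close>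
    define z where "z = G *\<^sub>v x"
    have z: "z \<in> carrier_vec n" using G x by (simp add: z_def)
    have YG: "Y *\<^sub>v z = Y *\<^sub>v (Y *\<^sub>v x) - of_real t \<cdot>\<^sub>v (Y *\<^sub>v x)"
      using x by (simp add: z_def Gv mult_minus_distrib_mat_vec[OF Y] mult_mat_vec[OF Y])
    have "F *\<^sub>v x = Y *\<^sub>v z + of_real t \<cdot>\<^sub>v z"
      unfolding YG using x carrier_vecD[OF vecs(2)[OF x(1)]] carrier_vecD[OF vecs(2)[OF vecs(2)[OF x(1)]]]
      by (intro eq_vecI) (auto simp: Fv z_def Gv power2_eq_square algebra_simps)
    then have "Re (ip (F *\<^sub>v x) z) = Re (ip (Y *\<^sub>v z) z) + t * (vec_norm z)\<^sup>2"
      using z by (simp add: ip_add_left[of _ n] ip_smult_left ip_self)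
    moreover have "0 < t * (vec_norm z)\<^sup>2" using t normG[OF x] by (simp add: z_def)
    ultimately show ?thesis using nonneg[OF z] shiftY[OF x(1)] by (simp add: z_def)
  qed
  obtain fs where fs: "char_poly Y = (\<Prod>e\<leftarrow>fs. [:- e, 1:])" "length fs = n"
    using char_poly_factorized[OF Y] by blast
  have fs_line: "Re e \<noteq> t" if e: "e \<in> set fs" for e
  proof
    assume et: "Re e = t"
    have ev: "eigenvalue Y e"
      using e by (auto simp: eigenvalue_root_char_poly[OF Y] fs poly_prod_list prod_list_zero_iff)
    then have "e = of_real t"
      using hermitian_eigenvalue_real[OF Y herm ev] et by (metis of_real_Re)
    then obtain x where x: "x \<in> carrier_vec n" "x \<noteq> 0\<^sub>v n" "Y *\<^sub>v x = of_real t \<cdot>\<^sub>v x"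
      using ev by (auto simp: eigenvalue_def eigenvector_def carrier_matD[OF Y])
    then show False using G0[of x] by (simp add: Gv)
  qed
  define r1 where "r1 = length (filter (\<lambda>e. 1 * (Re e + t) < 0) es)"
  define r2 where "r2 = length (filter (\<lambda>e. - 1 * (Re e + t) < 0) es)"
  define q1 where "q1 = length (filter (\<lambda>e. 1 * (Re e + - t) < 0) fs)"
  define q2 where "q2 = length (filter (\<lambda>e. - 1 * (Re e + - t) < 0) fs)"
  have compl: "length (filter P xs) + length (filter Q xs) = length xs"
    if "\<And>e. e \<in> set xs \<Longrightarrow> Q e \<longleftrightarrow> \<not> P e" for P Q and xs :: "complex list"
    using sum_length_filter_compl[of P xs] filter_cong[of xs xs Q "\<lambda>e. \<not> P e"] that by simp
  have r: "r1 + r2 = n"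
    unfolding r1_def r2_def es(2)[symmetric]
    by (intro compl) (use line in \<open>fastforce simp: t_def\<close>)
  have q: "q1 + q2 = n"
    unfolding q1_def q2_def fs(2)[symmetric]
    by (intro compl) (use fs_line in fastforce)
  have one: "(1 :: real)\<^sup>2 = 1" and minus_one: "(- 1 :: real)\<^sup>2 = 1" by simp_all
  \<comment> \<open>A subspace of dimension above \<open>m\<close> meets
    \<open>ker B\<^sup>*\<close>, where the form of \<open>K\<close> is nonnegative.\<close>
  have "r1 \<le> m"
  proof (rule ccontr)
    assume "\<not> r1 \<le> m"
    from inertia_subspace[OF N es(1) one r1_def K hermK posK] obtain W where
      W: "W \<in> carrier_mat n r1" and neg: "\<forall>w \<in> carrier_vec r1. w \<noteq> 0\<^sub>v r1 \<longrightarrow>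
        W *\<^sub>v w \<noteq> 0\<^sub>v n \<and> 1 * Re (ip (K *\<^sub>v (W *\<^sub>v w)) (W *\<^sub>v w)) < 0"
      by (rule bexE)
    have BW: "mat_adjoint B * W \<in> carrier_mat m r1"
      using W by (auto intro!: mult_carrier_mat mat_adjoint_carrier[OF B])
    obtain w where w: "w \<in> carrier_vec r1" "w \<noteq> 0\<^sub>v r1" "(mat_adjoint B * W) *\<^sub>v w = 0\<^sub>v m"
      using wide_mat_kernel[OF BW] \<open>\<not> r1 \<le> m\<close> by auto
    have Ww: "W *\<^sub>v w \<in> carrier_vec n" using W w by simp
    have "mat_adjoint B *\<^sub>v (W *\<^sub>v w) = 0\<^sub>v m"
      using assoc_mult_mat_vec[OF mat_adjoint_carrier[OF B] W w(1)] w(3) by simp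
    then have "Re (ip (Y *\<^sub>v (W *\<^sub>v w)) (W *\<^sub>v w)) \<le> h / 2 * (vec_norm (W *\<^sub>v w))\<^sup>2"
      using kernel_bounds(2)[OF Ww] by simp
    also have "\<dots> \<le> t * (vec_norm (W *\<^sub>v w))\<^sup>2"
      using h by (intro mult_right_mono) (auto simp: t_def)
    finally have "0 \<le> Re (ip (K *\<^sub>v (W *\<^sub>v w)) (W *\<^sub>v w))"
      using Ww by (simp add: Kv ip_diff_left[of _ n] ip_smult_left ip_self)
    then show False using bspec[OF neg w(1)] w(2) by simp
  qed
  \<comment> \<open>\<open>F\<close> is used because its negativity says
    \<open>\<parallel>Y x\<parallel> < t \<parallel>x\<parallel>\<close>, directly against the norm
    bound \<open>range_lower\<close>.\<close>
  moreover have "q1 \<le> n - m"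
  proof (rule ccontr)
    assume "\<not> q1 \<le> n - m"
    then have "n < q1 + m" using \<open>m \<le> n\<close> by simp
    from inertia_subspace[OF Y fs(1) one q1_def F hermF posF] obtain W where
      W: "W \<in> carrier_mat n q1" and neg: "\<forall>w \<in> carrier_vec q1. w \<noteq> 0\<^sub>v q1 \<longrightarrow>
        W *\<^sub>v w \<noteq> 0\<^sub>v n \<and> 1 * Re (ip (F *\<^sub>v (W *\<^sub>v w)) (W *\<^sub>v w)) < 0"
      by (rule bexE)
    obtain u w where u: "u \<in> carrier_vec q1" and w: "w \<in> carrier_vec m"
      and nz: "u \<noteq> 0\<^sub>v q1 \<or> w \<noteq> 0\<^sub>v m" and eq: "W *\<^sub>v u = B *\<^sub>v w"
      using ranges_intersect[OF W B \<open>n < q1 + m\<close>] by blast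
    have "u \<noteq> 0\<^sub>v q1"
    proof
      assume "u = 0\<^sub>v q1"
      then have "B *\<^sub>v w = 0\<^sub>v n" using eq W by (metis mult_mat_vec_zero)
      then have "8 * h\<^sup>2 * (vec_norm w)\<^sup>2 \<le> 0" using lower[OF w] by (simp add: vec_norm_def)
      then have "w = 0\<^sub>v m" using h vec_norm_eq_0_iff[OF w] by (simp add: mult_le_0_iff)
      then show False using nz \<open>u = 0\<^sub>v q1\<close> by simp
    qed
    from bspec[OF neg u] this have "Re (ip (F *\<^sub>v (B *\<^sub>v w)) (B *\<^sub>v w)) < 0" by (simp add: eq)
    then have "(vec_norm (Y *\<^sub>v (B *\<^sub>v w)))\<^sup>2 < (t * vec_norm (B *\<^sub>v w))\<^sup>2"
      using w by (simp add: Fv ip_diff_left[of _ n] ip_smult_left ip_self herm power_mult_distrib)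
    moreover have "(t * vec_norm (B *\<^sub>v w))\<^sup>2 \<le> (2 * h * vec_norm (B *\<^sub>v w))\<^sup>2"
      using h by (intro power_mono mult_right_mono) (auto simp: t_def)
    moreover have "(2 * h * vec_norm (B *\<^sub>v w))\<^sup>2 \<le> (vec_norm (Y *\<^sub>v (B *\<^sub>v w)))\<^sup>2"
      using h by (intro power_mono range_lower[OF w]) auto
    ultimately show False by simp
  qed
  \<comment> \<open>The forms of \<open>K\<close> and \<open>G = - K\<close> cannot both be positive
    at a common vector.\<close>
  moreover have "r2 + q2 \<le> n"
  proof (rule ccontr)
    assume "\<not> r2 + q2 \<le> n"
    then have "n < r2 + q2" by simp
    from inertia_subspace[OF N es(1) minus_one r2_def K hermK posK] obtain W where
      W: "W \<in> carrier_mat n r2" and neg: "\<forall>w \<in> carrier_vec r2. w \<noteq> 0\<^sub>v r2 \<longrightarrow>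
        W *\<^sub>v w \<noteq> 0\<^sub>v n \<and> - 1 * Re (ip (K *\<^sub>v (W *\<^sub>v w)) (W *\<^sub>v w)) < 0"
      by (rule bexE)
    from inertia_subspace[OF Y fs(1) minus_one q2_def G hermG posG] obtain U where
      U: "U \<in> carrier_mat n q2" and neg': "\<forall>w \<in> carrier_vec q2. w \<noteq> 0\<^sub>v q2 \<longrightarrow>
        U *\<^sub>v w \<noteq> 0\<^sub>v n \<and> - 1 * Re (ip (G *\<^sub>v (U *\<^sub>v w)) (U *\<^sub>v w)) < 0"
      by (rule bexE)
    obtain u w where u: "u \<in> carrier_vec r2" and w: "w \<in> carrier_vec q2"
      and nz: "u \<noteq> 0\<^sub>v r2 \<or> w \<noteq> 0\<^sub>v q2" and eq: "W *\<^sub>v u = U *\<^sub>v w"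
      using ranges_intersect[OF W U \<open>n < r2 + q2\<close>] by blast
    \<comment> \<open>If one coefficient vector vanished, injectivity of the other matrix would make
      both vanish.\<close>
    have "u \<noteq> 0\<^sub>v r2"
      using nz bspec[OF neg' w] eq W by (metis mult_mat_vec_zero)
    moreover have "w \<noteq> 0\<^sub>v q2"
      using nz bspec[OF neg u] eq U by (metis mult_mat_vec_zero)
    ultimately have "0 < Re (ip (K *\<^sub>v (W *\<^sub>v u)) (W *\<^sub>v u))" "0 < Re (ip (G *\<^sub>v (W *\<^sub>v u)) (W *\<^sub>v u))"
      using bspec[OF neg u] bspec[OF neg' w] eq by auto
    then show False using real_Y[of "W *\<^sub>v u"] W u by simp
  qed
  ultimately have "r1 = m" "r2 = n - m" using r q \<open>m \<le> n\<close> by auto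
  moreover have "filter (\<lambda>e. 1 * (Re e + t) < 0) es = filter (\<lambda>e. Re e < - (3 / 2 * h)) es"
    "filter (\<lambda>e. - 1 * (Re e + t) < 0) es = filter (\<lambda>e. - (3 / 2 * h) < Re e) es"
    by (auto simp: t_def intro!: filter_cong)
  ultimately show "length (filter (\<lambda>e. Re e < - (3 / 2 * h)) es) = m"
    "length (filter (\<lambda>e. - (3 / 2 * h) < Re e) es) = n - m"
    by (simp_all only: r1_def r2_def)
qed

end

section \<open>Assertions for \<open>A - Y\<close> and transfer to the closed-loop matrix\<close>

lemma rho_le_rho1: "rho n B l v k \<le> rho1 n B l v k"
proof -
  let ?Q = "1 + 2 * ((op_norm B)\<^sup>2 / (spectral_gap n l k)\<^sup>2)"
  have "1 \<le> ?Q" by simp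
  then have "1 \<le> sqrt ?Q" by simp
  then have "sqrt ?Q * 1 \<le> sqrt ?Q * sqrt ?Q" by (intro mult_left_mono) auto
  then have "sqrt ?Q \<le> ?Q" using \<open>1 \<le> ?Q\<close> by simp
  moreover have "0 < ?Q" "0 < sqrt ?Q" using \<open>1 \<le> ?Q\<close> \<open>1 \<le> sqrt ?Q\<close> by linarith+
  ultimately show ?thesis
    unfolding rho_def rho1_def by (auto intro: divide_left_mono simp del: real_sqrt_gt_0_iff)
qed

context riccati
begin

lemma eigen_locale:
  assumes "\<mu> \<in> spectrum (A - Y)"
  obtains y where "riccati_eigen n m A B Y l v y \<mu>"
proof -
  have N: "A - Y \<in> carrier_mat n n" by (intro minus_carrier_mat) auto
  obtain y where y: "y \<in> carrier_vec n" "y \<noteq> 0\<^sub>v n" "(A - Y) *\<^sub>v y = \<mu> \<cdot>\<^sub>v y"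
    using assms carrier_matD[OF N] by (auto simp: spectrum_def eigenvalue_def eigenvector_def)
  then have "A *\<^sub>v y - Y *\<^sub>v y = \<mu> \<cdot>\<^sub>v y"
    using minus_mult_distrib_mat_vec[OF A Y y(1)] by simp
  then have "riccati_eigen n m A B Y l v y \<mu>"
    using y by unfold_locales
  then show thesis by (rule that)
qed

lemma spectrum_location:
  assumes \<mu>: "\<mu> \<in> spectrum (A - Y)"
  shows "\<mu> \<in> complex_box {- op_norm B..<0} {l 1..l n}"
    and "k \<in> {1..n - 1} \<Longrightarrow> \<mu> \<notin> right_triangle l k"
    and "k \<in> {1..n} \<Longrightarrow> \<mu> \<notin> cball (\<i> * complex_of_real (l k)) (rho1 n B l v k)"
proof -
  obtain y where "riccati_eigen n m A B Y l v y \<mu>" using eigen_locale[OF \<mu>] .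
  then interpret E: riccati_eigen n m A B Y l v y \<mu> .
  show "\<mu> \<in> complex_box {- op_norm B..<0} {l 1..l n}"
    using E.a_pos E.a_le_op_norm E.Im_bounds by (simp add: complex_box_def)
  show "k \<in> {1..n - 1} \<Longrightarrow> \<mu> \<notin> right_triangle l k" by (rule E.not_in_right_triangle)
  show "k \<in> {1..n} \<Longrightarrow> \<mu> \<notin> cball (\<i> * complex_of_real (l k)) (rho1 n B l v k)"
    using E.not_in_disk1[of k] by (simp add: dist_norm norm_minus_commute)
qed

lemma eigenvalue_counts:
  defines "\<sigma> \<equiv> smallest_singular_value B" and "\<Delta> \<equiv> l n - l 1"
  assumes "1 \<le> m" "m \<le> n" and large: "2 * sqrt 2 * \<Delta> < \<sigma>"
  shows "eigenvalue_count (A - Y) (complex_box {- op_norm B..- (sqrt 6 / 4) * \<sigma>} {l 1..l n}) = m"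
    and "eigenvalue_count (A - Y) (complex_box {- sqrt 3 * \<Delta><..<0} {l 1..l n}) = n - m"
proof -
  have \<Delta>: "0 \<le> \<Delta>" using eigenvalues_mono[of 1 n] n by (simp add: \<Delta>_def)
  then have \<sigma>: "0 < \<sigma>" using large by (smt (verit) mult_nonneg_nonneg real_sqrt_ge_zero)
  have lower: "\<sigma> * vec_norm w \<le> vec_norm (B *\<^sub>v w)" if "w \<in> carrier_vec m" for w
    unfolding \<sigma>_def using \<sigma> that assms(3) by (intro smallest_singular_value_le[OF B]) (auto simp: \<sigma>_def)
  \<comment> \<open>With this \<open>h\<close>, \<open>\<sigma>\<^sup>2 = 8 h\<^sup>2\<close> and
    the hypothesis \<open>large\<close> reads \<open>\<Delta> < h\<close>.\<close>
  define h where "h = \<sigma> / (2 * sqrt 2)"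
  have h: "0 < h" "\<Delta> < h" and \<sigma>h: "\<sigma>\<^sup>2 = 8 * h\<^sup>2"
    using \<sigma> large by (auto simp: h_def field_simps power2_eq_square)
  interpret L: riccati_large n m A B Y l v h
  proof
    show "0 < h" by (rule h)
    show "l n - l 1 \<le> h" using h by (simp add: \<Delta>_def)
    show "8 * h\<^sup>2 * (vec_norm w)\<^sup>2 \<le> (vec_norm (B *\<^sub>v w))\<^sup>2" if "w \<in> carrier_vec m" for w
      unfolding \<sigma>h[symmetric] power_mult_distrib[symmetric]
      using lower[OF that] \<sigma> by (intro power_mono) auto
  qed
  define N where "N = A - Y"
  have N: "N \<in> carrier_mat n n" unfolding N_def by (intro minus_carrier_mat) auto
  obtain es where es: "char_poly N = (\<Prod>e\<leftarrow>es. [:- e, 1:])" "length es = n"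
    using char_poly_factorized[OF N] by blast
  have spec: "e \<in> spectrum N" if "e \<in> set es" for e
    using that by (auto simp: spectrum_def eigenvalue_root_char_poly[OF N] es poly_prod_list prod_list_zero_iff)
  have box: "e \<in> complex_box {- op_norm B..<0} {l 1..l n}" if "e \<in> set es" for e
    using spectrum_location(1) spec[OF that] by (simp add: N_def)
  have gap: "8 * h\<^sup>2 * 3 < 8 * (Re e)\<^sup>2" if e: "e \<in> set es" "9 / 4 * \<Delta>\<^sup>2 \<le> (Re e)\<^sup>2" for e
  proof -
    obtain y where "riccati_eigen n m A B Y l v y e"
      using eigen_locale spec[OF e(1)] by (auto simp: N_def)
    then interpret E: riccati_eigen n m A B Y l v y e .
    show ?thesis
      using E.spectral_dichotomy[OF less_imp_le[OF \<sigma>] lower] e(2) by (simp add: \<Delta>_def \<sigma>h)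
  qed
  have \<Delta>h: "\<Delta>\<^sup>2 < h\<^sup>2" using \<Delta> h by (intro power_strict_mono) auto
  have sq_iff: "c < - Re e \<longleftrightarrow> c\<^sup>2 < (Re e)\<^sup>2" "c \<le> - Re e \<longleftrightarrow> c\<^sup>2 \<le> (Re e)\<^sup>2"
    if "e \<in> set es" "0 \<le> c" for c e
    using box[OF that(1)] that(2) abs_le_square_iff[of c "Re e"] abs_le_square_iff[of "Re e" c]
    by (auto simp: complex_box_def)
  \<comment> \<open>No squared real part lies in
    \<open>[9 / 4 \<Delta>\<^sup>2, 3 h\<^sup>2]\<close>. This window contains the squares
    \<open>9 / 4 h\<^sup>2\<close>, \<open>3 h\<^sup>2\<close> and \<open>3 \<Delta>\<^sup>2\<close>
    of the dividing line and of both box edges, so all three separate the spectrum alike.\<close>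
  have big: "(Re e)\<^sup>2 < 9 / 4 * \<Delta>\<^sup>2 \<or> 3 * h\<^sup>2 < (Re e)\<^sup>2" if "e \<in> set es" for e
    using gap[OF that] by linarith
  have t2: "(3 / 2 * h)\<^sup>2 = 9 / 4 * h\<^sup>2" by (simp add: power2_eq_square)
  have s6: "(sqrt 6 / 4 * \<sigma>)\<^sup>2 = 3 * h\<^sup>2"
    by (simp add: power_mult_distrib power_divide \<sigma>h)
  have s3: "(sqrt 3 * \<Delta>)\<^sup>2 = 3 * \<Delta>\<^sup>2" by (simp add: power_mult_distrib)
  have h2: "0 < h\<^sup>2" and \<Delta>2: "0 \<le> \<Delta>\<^sup>2" using h by auto
  have c6: "0 \<le> sqrt 6 / 4 * \<sigma>" and c3: "0 \<le> sqrt 3 * \<Delta>" and ct: "0 \<le> 3 / 2 * h" using \<sigma> \<Delta> h by auto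
  have "Re e \<noteq> - (3 / 2 * h)" if "e \<in> set es" for e
  proof
    assume "Re e = - (3 / 2 * h)"
    then have "(Re e)\<^sup>2 = 9 / 4 * h\<^sup>2" by (simp add: power2_eq_square)
    then show False using big[OF that] \<Delta>h h2 by linarith
  qed
  from L.closed_loop_split[OF assms(4) es(1)[unfolded N_def] es(2) this]
  have counts: "length (filter (\<lambda>e. Re e < - (3 / 2 * h)) es) = m"
    "length (filter (\<lambda>e. - (3 / 2 * h) < Re e) es) = n - m" by auto
  have "e \<in> complex_box {- op_norm B..- (sqrt 6 / 4) * \<sigma>} {l 1..l n} \<longleftrightarrow> Re e < - (3 / 2 * h)"
    if e: "e \<in> set es" for e
  proof -
    have "sqrt 6 / 4 * \<sigma> \<le> - Re e \<longleftrightarrow> 3 / 2 * h < - Re e"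
      unfolding sq_iff(1)[OF e ct] sq_iff(2)[OF e c6] s6 t2 using big[OF e] \<Delta>h h2 by linarith
    then show ?thesis using box[OF e] by (auto simp: complex_box_def)
  qed
  then show "eigenvalue_count (A - Y) (complex_box {- op_norm B..- (sqrt 6 / 4) * \<sigma>} {l 1..l n}) = m"
    unfolding eigenvalue_count_eq[OF N es(1), unfolded N_def] counts(1)[symmetric]
    by (metis (mono_tags, lifting) filter_cong)
  have "e \<in> complex_box {- sqrt 3 * \<Delta><..<0} {l 1..l n} \<longleftrightarrow> - (3 / 2 * h) < Re e"
    if e: "e \<in> set es" for e
  proof -
    have "sqrt 3 * \<Delta> \<le> - Re e \<longleftrightarrow> 3 / 2 * h \<le> - Re e"
      unfolding sq_iff(2)[OF e ct] sq_iff(2)[OF e c3] s3 t2 using big[OF e] \<Delta>h h2 \<Delta>2 by linarith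
    then show ?thesis using box[OF e] by (auto simp: complex_box_def)
  qed
  then show "eigenvalue_count (A - Y) (complex_box {- sqrt 3 * \<Delta><..<0} {l 1..l n}) = n - m"
    unfolding eigenvalue_count_eq[OF N es(1), unfolded N_def] counts(2)[symmetric]
    by (metis (mono_tags, lifting) filter_cong)
qed

end

text \<open>With \<open>z = X x\<close>, so \<open>x = Y z\<close>, the equation \<open>ricY\<close>
  gives \<open>A x - B B\<^sup>* z = Y (A - Y) z\<close>; hence the closed-loop matrix is
  \<open>Y (A - Y) X\<close>.\<close>

lemma closed_loop_similar:
  assumes "2 \<le> n" and A: "A \<in> carrier_mat n n" and B: "B \<in> carrier_mat n m"
    and skew: "skew_hermitian A" and X: "lqr_riccati_solution A B X"
    and basis: "ordered_eigenbasis n A l v"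
  obtains Y where "riccati n m A B Y l v" "char_poly (lqr_closed_loop A B X) = char_poly (A - Y)"
    "spectrum (lqr_closed_loop A B X) = spectrum (A - Y)"
proof -
  have Xc [simp]: "X \<in> carrier_mat n n" using X A by (auto simp: lqr_riccati_solution_def)
  note AB [simp] = A B
  have vecs [simp]: "A *\<^sub>v x \<in> carrier_vec n" "X *\<^sub>v x \<in> carrier_vec n" "mat_adjoint B *\<^sub>v x \<in> carrier_vec m"
    if "x \<in> carrier_vec n" for x
    using that by (auto intro!: mult_mat_vec_carrier[OF A] mult_mat_vec_carrier[OF Xc]
        mult_mat_vec_carrier[OF mat_adjoint_carrier[OF B]])
  have vecsB [simp]: "B *\<^sub>v w \<in> carrier_vec n" if "w \<in> carrier_vec m" for w
    using that by (rule mult_mat_vec_carrier[OF B])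
  have adjA: "mat_adjoint A = - A" using skew by (simp add: skew_hermitian_def)
  have skewA: "ip (A *\<^sub>v x) y = - ip x (A *\<^sub>v y)" if "x \<in> carrier_vec n" "y \<in> carrier_vec n" for x y
  proof -
    have "mat_adjoint A *\<^sub>v y = (- 1) \<cdot>\<^sub>v (A *\<^sub>v y)"
      unfolding adjA using that carrier_vecD[OF vecs(1)[OF that(2)]] carrier_matD[OF A]
      by (intro eq_vecI) auto
    then show ?thesis using ip_adjoint[OF A that] that by (simp add: ip_smult_right[of _ n])
  qed
  have "mat_adjoint X = X" using X by (auto simp: lqr_riccati_solution_def nonneg_mat_def)
  then have hermX: "ip (X *\<^sub>v x) y = ip x (X *\<^sub>v y)" if "x \<in> carrier_vec n" "y \<in> carrier_vec n" for x y
    using ip_adjoint[OF Xc that] by simp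
  have nonnegX: "0 \<le> Re (ip (X *\<^sub>v x) x)" if "x \<in> carrier_vec n" for x
    using X that ip_cscalar[of "X *\<^sub>v x" n x] carrier_matD[OF Xc]
    by (simp add: lqr_riccati_solution_def nonneg_mat_def)
  have ricX: "X *\<^sub>v (B *\<^sub>v (mat_adjoint B *\<^sub>v (X *\<^sub>v x))) - X *\<^sub>v (A *\<^sub>v x) + A *\<^sub>v (X *\<^sub>v x) - x = 0\<^sub>v n"
    if x: "x \<in> carrier_vec n" for x
  proof -
    have XB: "X * B \<in> carrier_mat n m" by (rule mult_carrier_mat[OF Xc B])
    have XBB: "X * B * mat_adjoint B \<in> carrier_mat n n"
      by (rule mult_carrier_mat[OF XB mat_adjoint_carrier[OF B]])
    have c: "X * B * mat_adjoint B * X \<in> carrier_mat n n" "X * A \<in> carrier_mat n n"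
      "mat_adjoint A * X \<in> carrier_mat n n"
      using mult_carrier_mat[OF XBB Xc] mult_carrier_mat[OF Xc A]
        mult_carrier_mat[OF mat_adjoint_carrier[OF A] Xc] by auto
    have "(X * B * mat_adjoint B * X - X * A - mat_adjoint A * X - 1\<^sub>m n) *\<^sub>v x = 0\<^sub>v n"
      using X x A by (auto simp: lqr_riccati_solution_def intro!: eq_vecI)
    moreover have "(X * B * mat_adjoint B * X - X * A - mat_adjoint A * X - 1\<^sub>m n) *\<^sub>v x
      = (X * B * mat_adjoint B * X) *\<^sub>v x - (X * A) *\<^sub>v x - (mat_adjoint A * X) *\<^sub>v x - x"
      using x c by (simp add: minus_mult_distrib_mat_vec[of _ n n] minus_carrier_mat)
    moreover have "(X * B * mat_adjoint B * X) *\<^sub>v x = X *\<^sub>v (B *\<^sub>v (mat_adjoint B *\<^sub>v (X *\<^sub>v x)))"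
      using x c by (simp add: assoc_mult_mat_vec[OF XBB Xc] assoc_mult_mat_vec[OF XB mat_adjoint_carrier[OF B]]
          assoc_mult_mat_vec[OF Xc B])
    moreover have "(X * A) *\<^sub>v x = X *\<^sub>v (A *\<^sub>v x)" by (rule assoc_mult_mat_vec[OF Xc A x])
    moreover have "(mat_adjoint A * X) *\<^sub>v x = (- 1) \<cdot>\<^sub>v (A *\<^sub>v (X *\<^sub>v x))"
    proof -
      have "(mat_adjoint A * X) *\<^sub>v x = mat_adjoint A *\<^sub>v (X *\<^sub>v x)"
        by (rule assoc_mult_mat_vec[OF mat_adjoint_carrier[OF A] Xc x])
      also have "\<dots> = (- 1) \<cdot>\<^sub>v (A *\<^sub>v (X *\<^sub>v x))"
        unfolding adjA using x carrier_vecD[OF vecs(2)[OF x]] carrier_matD[OF A]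
        by (intro eq_vecI) auto
      finally show ?thesis .
    qed
    ultimately show ?thesis
      using x carrier_vecD[OF vecs(1)[OF vecs(2)[OF x]]] carrier_vecD[OF vecs(2)[OF vecs(1)[OF x]]]
      by (auto simp: vec_eq_iff)
  qed
  \<comment> \<open>If \<open>X x = 0\<close>, the Riccati equation at \<open>x\<close> reduces to
    \<open>x = - X A x\<close>, so
    \<open>\<langle>x, x\<rangle> = - \<langle>A x, X x\<rangle> = 0\<close>.\<close>
  have injX: "x = 0\<^sub>v n" if x: "x \<in> carrier_vec n" and 0: "X *\<^sub>v x = 0\<^sub>v n" for x
  proof -
    have "mat_adjoint B *\<^sub>v 0\<^sub>v n = 0\<^sub>v m" by (rule mult_mat_vec_zero[OF mat_adjoint_carrier[OF B]])
    then have "x = (- 1) \<cdot>\<^sub>v (X *\<^sub>v (A *\<^sub>v x))"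
      using ricX[OF x] x carrier_vecD[OF vecs(2)[OF vecs(1)[OF x]]]
      by (simp add: 0 mult_mat_vec_zero[OF A] mult_mat_vec_zero[OF B] mult_mat_vec_zero[OF Xc])
        (auto simp: vec_eq_iff eq_neg_iff_add_eq_0 add.commute)
    then have "ip x x = - ip (X *\<^sub>v (A *\<^sub>v x)) x" by (metis ip_smult_left mult_minus1)
    also have "\<dots> = 0" using x by (simp add: hermX 0)
    finally show ?thesis using vec_norm_eq_0_iff[OF x] by (simp add: ip_self)
  qed
  obtain Y where Y [simp]: "Y \<in> carrier_mat n n" and XY: "X * Y = 1\<^sub>m n" and YX: "Y * X = 1\<^sub>m n"
    using invertible_matI[OF Xc injX] by blast
  have vecsY [simp]: "Y *\<^sub>v x \<in> carrier_vec n" if "x \<in> carrier_vec n" for x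
    using that by (rule mult_mat_vec_carrier[OF Y])
  have XYv [simp]: "X *\<^sub>v (Y *\<^sub>v x) = x" if "x \<in> carrier_vec n" for x
    using that assoc_mult_mat_vec[OF Xc Y that] XY by simp
  have YXv [simp]: "Y *\<^sub>v (X *\<^sub>v x) = x" if "x \<in> carrier_vec n" for x
    using that assoc_mult_mat_vec[OF Y Xc that] YX by simp
  \<comment> \<open>Apply \<open>ricX\<close> at \<open>Y z\<close> and multiply by \<open>Y\<close>
    from the left.\<close>
  have ricY: "B *\<^sub>v (mat_adjoint B *\<^sub>v z) = Y *\<^sub>v (Y *\<^sub>v z) + A *\<^sub>v (Y *\<^sub>v z) - Y *\<^sub>v (A *\<^sub>v z)"
    if z: "z \<in> carrier_vec n" for z
  proof -
    let ?b = "B *\<^sub>v (mat_adjoint B *\<^sub>v z)"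
    have b: "?b \<in> carrier_vec n" using z by simp
    have "X *\<^sub>v ?b - X *\<^sub>v (A *\<^sub>v (Y *\<^sub>v z)) + A *\<^sub>v z - Y *\<^sub>v z = 0\<^sub>v n"
      using ricX[of "Y *\<^sub>v z"] z by simp
    then have "Y *\<^sub>v (X *\<^sub>v ?b - X *\<^sub>v (A *\<^sub>v (Y *\<^sub>v z)) + A *\<^sub>v z - Y *\<^sub>v z) = 0\<^sub>v n"
      by (simp add: mult_mat_vec_zero[OF Y])
    then have "?b - A *\<^sub>v (Y *\<^sub>v z) + Y *\<^sub>v (A *\<^sub>v z) - Y *\<^sub>v (Y *\<^sub>v z) = 0\<^sub>v n"
      using z b by (simp add: mult_minus_distrib_mat_vec[OF Y] mult_add_distrib_mat_vec[OF Y])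
    then show ?thesis
      using z b carrier_vecD[OF b] carrier_vecD[OF vecsY[OF vecsY[OF z]]]
        carrier_vecD[OF vecsY[OF vecs(1)[OF z]]] carrier_vecD[OF vecs(1)[OF vecsY[OF z]]]
      by (auto simp: vec_eq_iff algebra_simps)
  qed
  have ric: "riccati n m A B Y l v"
  proof
    show "ip (Y *\<^sub>v x) y = ip x (Y *\<^sub>v y)" if "x \<in> carrier_vec n" "y \<in> carrier_vec n" for x y
      using hermX[of "Y *\<^sub>v x" "Y *\<^sub>v y"] that by simp
    show "0 \<le> Re (ip (Y *\<^sub>v x) x)" if "x \<in> carrier_vec n" for x
      using nonnegX[of "Y *\<^sub>v x"] Re_ip_commute[of x n "Y *\<^sub>v x"] that by simp
    show "x = 0\<^sub>v n" if "x \<in> carrier_vec n" "Y *\<^sub>v x = 0\<^sub>v n" for x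
      using XYv[OF that(1)] that(2) mult_mat_vec_zero[OF Xc] by simp
  qed (fact A B Y skewA ricY basis assms(1))+
  define M where "M = lqr_closed_loop A B X"
  define N where "N = A - Y"
  have N: "N \<in> carrier_mat n n" unfolding N_def by (intro minus_carrier_mat) auto
  have BX: "mat_adjoint B * X \<in> carrier_mat m n"
    by (auto intro!: mult_carrier_mat mat_adjoint_carrier[OF B])
  have M: "M \<in> carrier_mat n n"
    unfolding M_def lqr_closed_loop_def by (rule minus_carrier_mat[OF mult_carrier_mat[OF B BX]])
  have YN: "Y * N \<in> carrier_mat n n" using N by (auto intro!: mult_carrier_mat)
  have "M = Y * N * X"
  proof (rule mat_eq_vecI[OF M])
    show "Y * N * X \<in> carrier_mat n n" using YN by (auto intro!: mult_carrier_mat)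
    fix x :: "complex vec" assume x: "x \<in> carrier_vec n"
    let ?z = "X *\<^sub>v x"
    have z: "?z \<in> carrier_vec n" using x by simp
    have "M *\<^sub>v x = A *\<^sub>v x - B *\<^sub>v (mat_adjoint B *\<^sub>v ?z)"
      unfolding M_def lqr_closed_loop_def using x BX
      by (subst minus_mult_distrib_mat_vec[of _ n n])
        (auto simp: assoc_mult_mat_vec[OF B BX] assoc_mult_mat_vec[OF mat_adjoint_carrier[OF B] Xc] mult_carrier_mat[OF B BX])
    also have "\<dots> = Y *\<^sub>v (A *\<^sub>v ?z) - Y *\<^sub>v (Y *\<^sub>v ?z)"
      using x z carrier_vecD[OF vecsY[OF vecsY[OF z]]]
        carrier_vecD[OF vecsY[OF vecs(1)[OF z]]] carrier_vecD[OF vecs(1)[OF x]] carrier_vecD[OF x]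
      by (subst ricY[OF z]) (auto simp: vec_eq_iff)
    also have "\<dots> = Y *\<^sub>v (N *\<^sub>v ?z)"
      using z by (simp add: N_def minus_mult_distrib_mat_vec[OF A Y] mult_minus_distrib_mat_vec[OF Y])
    also have "\<dots> = (Y * N * X) *\<^sub>v x"
      using z x by (simp add: assoc_mult_mat_vec[OF YN Xc] assoc_mult_mat_vec[OF Y N])
    finally show "M *\<^sub>v x = (Y * N * X) *\<^sub>v x" .
  qed
  then have "similar_mat M N"
    unfolding similar_mat_def using similar_mat_witI[OF YX XY _ M N Y Xc] by blast
  then have cp: "char_poly M = char_poly N" by (rule char_poly_similar)
  then have "spectrum M = spectrum N"
    by (auto simp: spectrum_def eigenvalue_root_char_poly[OF M] eigenvalue_root_char_poly[OF N])
  then show thesis using that[OF ric] cp by (simp add: M_def N_def)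
qed

theorem theorem2:
  fixes n m :: nat
    and A B X :: "complex mat"
    and l :: "nat \<Rightarrow> real"
    and v :: "nat \<Rightarrow> cvec"
  defines "M \<equiv> lqr_closed_loop A B X"
    and "\<Delta> \<equiv> l n - l 1"
    and "\<sigma> \<equiv> smallest_singular_value B"
  assumes "2 \<le> n" and "1 \<le> m" and "m \<le> n"
    and "A \<in> carrier_mat n n" and "B \<in> carrier_mat n m"
    and "skew_hermitian A"
    and "mat_kernel B = {0\<^sub>v m}"
    and "stabilizable A B"
    and "lqr_riccati_solution A B X"
    and "ordered_eigenbasis n A l v"
  shows
    "(\<forall>\<mu> \<in> spectrum M.
        \<mu> \<in> complex_box {- op_norm B..<0} {l 1..l n} \<and>
        (\<forall>k \<in> {1..n - 1}. \<mu> \<notin> right_triangle l k) \<and>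
        (\<forall>k \<in> {1..n}. \<mu> \<notin> cball (\<i> * complex_of_real (l k)) (rho n B l v k)))
     \<and>
     (2 * sqrt 2 * \<Delta> < \<sigma> \<longrightarrow>
        eigenvalue_count M
          (complex_box {- op_norm B..- (sqrt 6 / 4) * \<sigma>} {l 1..l n}) = m \<and>
        eigenvalue_count M
          (complex_box {- sqrt 3 * \<Delta><..<0} {l 1..l n}) = n - m)
     \<and>
     (m = 1 \<longrightarrow>
        (\<forall>\<mu> \<in> spectrum M.
           \<mu> \<in> complex_box {- op_norm B..<0} {l 1..l n} \<and>
           (\<forall>k \<in> {1..n - 1}. \<mu> \<notin> right_triangle l k) \<and>
           (\<forall>k \<in> {1..n}. \<mu> \<notin> cball (\<i> * complex_of_real (l k)) (rho1 n B l v k))))"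
proof -
  obtain Y where "riccati n m A B Y l v"
    and cp: "char_poly M = char_poly (A - Y)" and spec: "spectrum M = spectrum (A - Y)"
    using closed_loop_similar[OF assms(4,7,8,9,12,13)] unfolding M_def by metis
  then interpret riccati n m A B Y l v by simp
  have count: "eigenvalue_count M S = eigenvalue_count (A - Y) S" for S
    by (simp add: eigenvalue_count_def cp spec)
  have rho1: "\<mu> \<in> complex_box {- op_norm B..<0} {l 1..l n} \<and>
      (\<forall>k \<in> {1..n - 1}. \<mu> \<notin> right_triangle l k) \<and>
      (\<forall>k \<in> {1..n}. \<mu> \<notin> cball (\<i> * complex_of_real (l k)) (rho1 n B l v k))"
    if "\<mu> \<in> spectrum M" for \<mu>
    using spectrum_location[of \<mu>] that unfolding spec by blast
  \<comment> \<open>The disk of radius \<open>rho\<close> is contained in that of radius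
    \<open>rho1\<close>, since \<open>sqrt Q \<le> Q\<close> for the common denominator
    \<open>Q \<ge> 1\<close>.\<close>
  moreover have "\<mu> \<notin> cball (\<i> * complex_of_real (l k)) (rho n B l v k)"
    if "\<mu> \<in> spectrum M" "k \<in> {1..n}" for \<mu> k
    using rho1[OF that(1)] that(2) rho_le_rho1[of n B l v k] subset_cball by blast
  moreover have "eigenvalue_count M (complex_box {- op_norm B..- (sqrt 6 / 4) * \<sigma>} {l 1..l n}) = m \<and>
      eigenvalue_count M (complex_box {- sqrt 3 * \<Delta><..<0} {l 1..l n}) = n - m"
    if "2 * sqrt 2 * \<Delta> < \<sigma>"
    using eigenvalue_counts[OF assms(5,6)] that unfolding count \<sigma>_def \<Delta>_def by blast
  ultimately show ?thesis by blast
qed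

end
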